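(* Let $\alpha:\hat{\mathfrak n}\to\hat{\mathfrak g}$ be a topologically split crossed module of topological Lie algebras over $\mathbb K$, with $\mathfrak n=\mathrm{im}(\alpha)$, $\mathfrak g=\hat{\mathfrak g}/\mathfrak n$, $\mathfrak z=\ker\alpha$. Let $\sigma:\mathfrak g\to\hat{\mathfrak g}$ be a continuous linear section of the quotient map, $S:\mathfrak g\to\mathrm{der}\,\hat{\mathfrak n}$ the outer action of $\mathfrak g$ on $\hat{\mathfrak n}$ defined by $S(x)(n):=\sigma(x).n$, and $\omega:\mathfrak g\times\mathfrak g\to\hat{\mathfrak n}$ a continuous alternating bilinear map with $R_\sigma=\alpha\circ\omega$, where $R_\sigma(x,y)=[\sigma(x),\sigma(y)]-\sigma([x,y])$. Then $d_S\omega\in Z^3(\mathfrak g,\mathfrak z)$ satisfies $\chi_\alpha=[d_S\omega]$ in $H^3(\mathfrak g,\mathfrak z)$.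
   Context: $\mathbb K$ is a topological field of characteristic $0$ (discrete topology allowed); topological vector spaces are Hausdorff; topological Lie algebras and modules have continuous bracket resp. action map. $C^p(\mathfrak g,V)$: continuous alternating $p$-linear maps; $Z^p,H^p$: continuous cocycles, cohomology with standard differential $d_{\mathfrak g}$. A subspace $W\subseteq V$ is topologically split if it is closed and $V\to V/W$ has a continuous linear section $s$ with $W\times V/W\to V$, $(w,x)\mapsto w+s(x)$ a topological isomorphism. A crossed module is a morphism $\alpha:\hat{\mathfrak n}\to\hat{\mathfrak g}$ of topological Lie algebras with a continuous $\hat{\mathfrak g}$-module structure on $\hat{\mathfrak n}$ such that $\alpha(x.h)=[x,\alpha(h)]$ and $\alpha(h).h'=[h,h']$. It is topologically split if $\ker\alpha\subseteq\hat{\mathfrak n}$ and $\mathrm{im}\,\alpha\subseteq\hat{\mathfrak g}$ are topologically split; then $\mathfrak n=\mathrm{im}\,\alpha$ is an ideal and $\alpha:\hat{\mathfrak n}\to\mathfrak n$ is viewed as a topologically split central extension by the $\hat{\mathfrak g}$-module $\mathfrak z=\ker\alpha$; $\mathfrak n$ acts trivially on $\mathfrak z$, so $\mathfrak z$ is a $\mathfrak g$-module. Let $q:\hat{\mathfrak g}\to\mathfrak g$ be the quotient map. Covariant differential: $(d_S\omega)(x,x',x'')=\sum_{\mathrm{cyc}}\big(S(x).\omega(x',x'')-\omega([x,x'],x'')\big)$ (sum over cyclic permutations of $(x,x',x'')$). Characteristic class $\chi_\alpha$: choose $f\in Z^2(\mathfrak n,\mathfrak z)$ with $\hat{\mathfrak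 n}\cong\mathfrak z\oplus_f\mathfrak n$ (i.e. $\mathfrak z\times\mathfrak n$ with bracket $[(z,n),(z',n')]=(f(n,n'),[n,n'])$); the $\hat{\mathfrak g}$-action is $x.(z,n)=(x.z+\theta(x,n),[x,n])$ with $\theta:\hat{\mathfrak g}\times\mathfrak n\to\mathfrak z$ continuous bilinear. Choose $\tilde f\in C^2(\hat{\mathfrak g},\mathfrak z)$ with $\tilde f|_{\hat{\mathfrak g}\times\mathfrak n}=\theta$; then $d_{\hat{\mathfrak g}}\tilde f=q^*\beta$ for some $\beta\in Z^3(\mathfrak g,\mathfrak z)$, and $\chi_\alpha:=[\beta]$, independent of the choices.
   Formalization: "Topologically split crossed module" also includes that α: n̂ → n = im(α) is a topological quotient map for the subspace topology of n, so that n̂ ≅ z ⊕_f n; split kernel and image alone do not ensure this, and χ_α is then undefined. *)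

theory Defs
  imports "HOL-Analysis.Analysis"
begin

section \<open>Topological vector spaces, Lie algebras and modules\<close>

class topological_field_char_0 =
  field_char_0 + topological_ab_group_add + topological_semigroup_mult +
  assumes tendsto_inverse_nhds: "x \<noteq> 0 \<Longrightarrow> filterlim inverse (nhds (inverse x)) (nhds x)"

locale topological_vector_space = vector_space smul
  for smul :: "'k::topological_field_char_0 \<Rightarrow> 'a::{topological_ab_group_add, t2_space} \<Rightarrow> 'a" +
  assumes continuous_scale: "continuous_on UNIV (\<lambda>(c, x). smul c x)"

locale topological_lie_algebra = topological_vector_space smul
  for smul :: "'k::topological_field_char_0 \<Rightarrow> 'a::{topological_ab_group_add, t2_space} \<Rightarrow> 'a" +
  fixes bracket :: "'a \<Rightarrow> 'a \<Rightarrow> 'a"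
  assumes bracket_linear_left: "Vector_Spaces.linear smul smul (\<lambda>x. bracket x y)"
    and bracket_linear_right: "Vector_Spaces.linear smul smul (\<lambda>y. bracket x y)"
    and bracket_self: "bracket x x = 0"
    and jacobi: "bracket x (bracket y z) + bracket y (bracket z x) + bracket z (bracket x y) = 0"
    and continuous_bracket: "continuous_on UNIV (\<lambda>(x, y). bracket x y)"

locale topological_lie_module =
  L: topological_lie_algebra scaleL bracketL + V: topological_vector_space scaleV
  for scaleL :: "'k::topological_field_char_0 \<Rightarrow> 'g::{topological_ab_group_add, t2_space} \<Rightarrow> 'g"
    and bracketL :: "'g \<Rightarrow> 'g \<Rightarrow> 'g"
    and scaleV :: "'k \<Rightarrow> 'v::{topological_ab_group_add, t2_space} \<Rightarrow> 'v" +
  fixes act :: "'g \<Rightarrow> 'v \<Rightarrow> 'v"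
  assumes act_linear_left: "Vector_Spaces.linear scaleL scaleV (\<lambda>x. act x v)"
    and act_linear_right: "Vector_Spaces.linear scaleV scaleV (\<lambda>v. act x v)"
    and act_bracket: "act (bracketL x y) v = act x (act y v) - act y (act x v)"
    and continuous_act: "continuous_on UNIV (\<lambda>(x, v). act x v)"


section \<open>Subspaces and quotients\<close>

text \<open>Subalgebras live on a subset of a type and quotients on a set of cosets, so both are
  described by explicit operations together with a topology, whose \<^const>\<open>topspace\<close> is the
  carrier.\<close>

record ('k, 'a) tvs =
  tvs_top :: "'a topology"
  tvs_plus :: "'a \<Rightarrow> 'a \<Rightarrow> 'a"
  tvs_scale :: "'k \<Rightarrow> 'a \<Rightarrow> 'a"

record ('k, 'a) tlie = "('k, 'a) tvs" +
  tlie_bracket :: "'a \<Rightarrow> 'a \<Rightarrow> 'a"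

abbreviation tvs_carrier :: "('k, 'a, 'm) tvs_scheme \<Rightarrow> 'a set" where
  "tvs_carrier D \<equiv> topspace (tvs_top D)"

definition sub_lie ::
  "('k \<Rightarrow> 'a \<Rightarrow> 'a) \<Rightarrow> ('a \<Rightarrow> 'a \<Rightarrow> 'a) \<Rightarrow> 'a::{ab_group_add, topological_space} set \<Rightarrow> ('k, 'a) tlie" where
  "sub_lie smul bracket A =
     \<lparr>tvs_top = top_of_set A, tvs_plus = (+), tvs_scale = smul, tlie_bracket = bracket\<rparr>"

definition coset :: "'a::ab_group_add set \<Rightarrow> 'a \<Rightarrow> 'a set" where
  "coset W x = {x + w | w. w \<in> W}"

definition quot_topology :: "'a::{ab_group_add, topological_space} set \<Rightarrow> 'a set topology" where
  "quot_topology W = topology (\<lambda>U. U \<subseteq> range (coset W) \<and> open (coset W -` U))"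

definition quot_lie ::
  "('k \<Rightarrow> 'a \<Rightarrow> 'a) \<Rightarrow> ('a \<Rightarrow> 'a \<Rightarrow> 'a) \<Rightarrow> 'a::{ab_group_add, topological_space} set \<Rightarrow> ('k, 'a set) tlie" where
  "quot_lie smul bracket W =
     \<lparr>tvs_top = quot_topology W,
      tvs_plus = (\<lambda>X Y. {x + y | x y. x \<in> X \<and> y \<in> Y}),
      tvs_scale = (\<lambda>c X. {smul c x + w | x w. x \<in> X \<and> w \<in> W}),
      tlie_bracket = (\<lambda>X Y. {bracket x y + w | x y w. x \<in> X \<and> y \<in> Y \<and> w \<in> W})\<rparr>"

definition quot_tvs ::
  "('k \<Rightarrow> 'a \<Rightarrow> 'a) \<Rightarrow> 'a::{ab_group_add, topological_space} set \<Rightarrow> ('k, 'a set) tvs" where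
  "quot_tvs smul W = tvs.truncate (quot_lie smul (\<lambda>_ _. 0) W)"

lemma istopology_quot: "istopology (\<lambda>U. U \<subseteq> range (coset W) \<and> open (coset W -` U))"
  unfolding istopology_def by (auto simp: vimage_Union)

lemma openin_quot_topology:
  "openin (quot_topology W) U \<longleftrightarrow> U \<subseteq> range (coset W) \<and> open (coset W -` U)"
  unfolding quot_topology_def by (simp add: istopology_quot)

lemma topspace_quot_topology: "topspace (quot_topology W) = range (coset W)"
proof -
  have "openin (quot_topology W) (range (coset W))"
    by (auto simp: openin_quot_topology vimage_def)
  then show ?thesis
    by (meson openin_quot_topology openin_subset openin_topspace subset_antisym)
qed

lemma quotient_map_coset: "quotient_map euclidean (quot_topology W) (coset W)"
  unfolding quotient_map_def by (auto simp: topspace_quot_topology openin_quot_topology vimage_def)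

lemma (in topological_vector_space)
  assumes S: "subspace W"
  shows quot_plus_coset:
      "tvs_plus (quot_lie smul br W) (coset W x) (coset W y) = coset W (x + y)"
    and quot_scale_coset:
      "tvs_scale (quot_lie smul br W) c (coset W x) = coset W (smul c x)"
proof -
  show "tvs_plus (quot_lie smul br W) (coset W x) (coset W y) = coset W (x + y)"
  proof (intro subset_antisym subsetI)
    fix u assume "u \<in> tvs_plus (quot_lie smul br W) (coset W x) (coset W y)"
    then obtain w1 w2 where w: "w1 \<in> W" "w2 \<in> W" "u = (x + w1) + (y + w2)"
      by (auto simp: quot_lie_def coset_def)
    then have "u = (x + y) + (w1 + w2)" by (simp add: ac_simps)
    then show "u \<in> coset W (x + y)"
      using subspace_add[OF S w(1,2)] by (auto simp: coset_def)
  next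
    fix u assume "u \<in> coset W (x + y)"
    then obtain w where w: "w \<in> W" "u = (x + 0) + (y + w)"
      by (auto simp: coset_def ac_simps)
    then show "u \<in> tvs_plus (quot_lie smul br W) (coset W x) (coset W y)"
      using subspace_0[OF S] unfolding quot_lie_def coset_def tvs.simps by blast
  qed
  show "tvs_scale (quot_lie smul br W) c (coset W x) = coset W (smul c x)"
  proof (intro subset_antisym subsetI)
    fix u assume "u \<in> tvs_scale (quot_lie smul br W) c (coset W x)"
    then obtain w1 w2 where w: "w1 \<in> W" "w2 \<in> W" "u = smul c (x + w1) + w2"
      by (auto simp: quot_lie_def coset_def)
    then have "u = smul c x + (smul c w1 + w2)" by (simp add: scale_right_distrib ac_simps)
    then show "u \<in> coset W (smul c x)"
      using subspace_add[OF S subspace_scale[OF S w(1)] w(2)] by (auto simp: coset_def)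
  next
    fix u assume "u \<in> coset W (smul c x)"
    then obtain w where w: "w \<in> W" "u = smul c (x + 0) + w"
      by (auto simp: coset_def)
    then show "u \<in> tvs_scale (quot_lie smul br W) c (coset W x)"
      using subspace_0[OF S] unfolding quot_lie_def coset_def tvs.simps by blast
  qed
qed

lemma (in topological_lie_algebra) quot_bracket_coset:
  assumes S: "subspace W"
    and I: "\<And>x w. w \<in> W \<Longrightarrow> bracket x w \<in> W" "\<And>x w. w \<in> W \<Longrightarrow> bracket w x \<in> W"
  shows "tlie_bracket (quot_lie smul bracket W) (coset W x) (coset W y) = coset W (bracket x y)"
proof (intro subset_antisym subsetI)
  fix u assume "u \<in> tlie_bracket (quot_lie smul bracket W) (coset W x) (coset W y)"
  then obtain w1 w2 w3 where
      w: "w1 \<in> W" "w2 \<in> W" "w3 \<in> W" "u = bracket (x + w1) (y + w2) + w3"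
    by (auto simp: quot_lie_def coset_def)
  have "bracket (x + w1) (y + w2) = bracket x (y + w2) + bracket w1 (y + w2)"
    by (rule module_hom.add[OF module_hom_linearI, OF bracket_linear_left])
  moreover have "bracket x (y + w2) = bracket x y + bracket x w2"
    by (rule module_hom.add[OF module_hom_linearI, OF bracket_linear_right])
  ultimately have "u = bracket x y + (bracket x w2 + bracket w1 (y + w2) + w3)"
    using w(4) by (simp add: ac_simps)
  moreover have "bracket x w2 + bracket w1 (y + w2) + w3 \<in> W"
    using w(1-3) by (intro subspace_add[OF S] I)
  ultimately show "u \<in> coset W (bracket x y)"
    by (auto simp: coset_def)
next
  fix u assume "u \<in> coset W (bracket x y)"
  then obtain w where w: "w \<in> W" "u = bracket (x + 0) (y + 0) + w"
    by (auto simp: coset_def)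
  then show "u \<in> tlie_bracket (quot_lie smul bracket W) (coset W x) (coset W y)"
    using subspace_0[OF S] unfolding quot_lie_def coset_def tlie.simps by blast
qed

definition tvs_linear ::
  "('k, 'a, 'm) tvs_scheme \<Rightarrow> ('k \<Rightarrow> 'v \<Rightarrow> 'v) \<Rightarrow> ('a \<Rightarrow> 'v::ab_group_add) \<Rightarrow> bool" where
  "tvs_linear D scaleV f \<longleftrightarrow>
     (\<forall>x\<in>tvs_carrier D. \<forall>y\<in>tvs_carrier D. f (tvs_plus D x y) = f x + f y) \<and>
     (\<forall>c. \<forall>x\<in>tvs_carrier D. f (tvs_scale D c x) = scaleV c (f x))"

definition continuous_linear_section ::
  "('k \<Rightarrow> 'a \<Rightarrow> 'a) \<Rightarrow> 'a::{ab_group_add, topological_space} set \<Rightarrow> ('a set \<Rightarrow> 'a) \<Rightarrow> bool" where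
  "continuous_linear_section smul W s \<longleftrightarrow>
     continuous_map (quot_topology W) euclidean s \<and>
     tvs_linear (quot_tvs smul W) smul s \<and>
     (\<forall>X\<in>range (coset W). coset W (s X) = X)"

definition topologically_split ::
  "('k::field \<Rightarrow> 'a \<Rightarrow> 'a) \<Rightarrow> 'a::{ab_group_add, topological_space} set \<Rightarrow> bool" where
  "topologically_split smul W \<longleftrightarrow>
     module.subspace smul W \<and> closed W \<and>
     (\<exists>s. continuous_linear_section smul W s \<and>
          homeomorphic_map (prod_topology (top_of_set W) (quot_topology W)) euclidean
            (\<lambda>(w, X). w + s X))"


section \<open>Continuous Lie algebra cohomology\<close>

text \<open>A \<open>p\<close>-cochain is a function on lists, extended by \<open>0\<close> outside the lists of length \<open>p\<close>
  over the carrier.  Its values lie in a subspace \<open>V\<close> of the ambient space.\<close>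

definition cochains ::
  "nat \<Rightarrow> ('k, 'a, 'm) tvs_scheme \<Rightarrow> ('k \<Rightarrow> 'v \<Rightarrow> 'v) \<Rightarrow> 'v::{ab_group_add, topological_space} set
    \<Rightarrow> ('a list \<Rightarrow> 'v) set" where
  "cochains p D scaleV V = {F.
     (\<forall>xs. \<not> (length xs = p \<and> set xs \<subseteq> tvs_carrier D) \<longrightarrow> F xs = 0) \<and>
     (\<forall>xs. length xs = p \<and> set xs \<subseteq> tvs_carrier D \<longrightarrow>
        F xs \<in> V \<and>
        (\<forall>i<p. tvs_linear D scaleV (\<lambda>x. F (xs[i := x]))) \<and>
        (\<not> distinct xs \<longrightarrow> F xs = 0)) \<and>
     continuous_map (product_topology (\<lambda>_. tvs_top D) {..<p}) (top_of_set V)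
       (\<lambda>v. F (map v [0..<p]))}"

definition alt_sign :: "nat \<Rightarrow> 'v::ab_group_add \<Rightarrow> 'v" where
  "alt_sign k v = (if even k then v else - v)"

definition lie_diff ::
  "('k, 'a) tlie \<Rightarrow> ('a \<Rightarrow> 'v \<Rightarrow> 'v) \<Rightarrow> ('a list \<Rightarrow> 'v::ab_group_add) \<Rightarrow> 'a list \<Rightarrow> 'v" where
  "lie_diff D act F xs =
     (if set xs \<subseteq> tvs_carrier D then
        (\<Sum>j<length xs. alt_sign j (act (xs ! j) (F (nths xs (- {j}))))) +
        (\<Sum>j<length xs. \<Sum>i<j.
           alt_sign (i + j) (F (tlie_bracket D (xs ! i) (xs ! j) # nths xs (- {i, j}))))
      else 0)"

definition cocycles ::
  "nat \<Rightarrow> ('k, 'a) tlie \<Rightarrow> ('a \<Rightarrow> 'v \<Rightarrow> 'v) \<Rightarrow> ('k \<Rightarrow> 'v \<Rightarrow> 'v) \<Rightarrow>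
    'v::{ab_group_add, topological_space} set \<Rightarrow> ('a list \<Rightarrow> 'v) set" where
  "cocycles p D act scaleV V = {F \<in> cochains p D scaleV V. lie_diff D act F = (\<lambda>_. 0)}"

definition coboundaries ::
  "nat \<Rightarrow> ('k, 'a) tlie \<Rightarrow> ('a \<Rightarrow> 'v \<Rightarrow> 'v) \<Rightarrow> ('k \<Rightarrow> 'v \<Rightarrow> 'v) \<Rightarrow>
    'v::{ab_group_add, topological_space} set \<Rightarrow> ('a list \<Rightarrow> 'v) set" where
  "coboundaries p D act scaleV V =
     (case p of 0 \<Rightarrow> {\<lambda>_. 0} | Suc m \<Rightarrow> lie_diff D act ` cochains m D scaleV V)"

definition cohomology_class ::
  "nat \<Rightarrow> ('k, 'a) tlie \<Rightarrow> ('a \<Rightarrow> 'v \<Rightarrow> 'v) \<Rightarrow> ('k \<Rightarrow> 'v \<Rightarrow> 'v) \<Rightarrow>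
    'v::{ab_group_add, topological_space} set \<Rightarrow> ('a list \<Rightarrow> 'v) \<Rightarrow> ('a list \<Rightarrow> 'v) set" where
  "cohomology_class p D act scaleV V F =
     {G \<in> cocycles p D act scaleV V. (\<lambda>xs. G xs - F xs) \<in> coboundaries p D act scaleV V}"

text \<open>The covariant differential of a \<open>2\<close>-cochain with respect to an outer action \<open>S\<close>.\<close>

definition covariant_diff ::
  "('k, 'a) tlie \<Rightarrow> ('a \<Rightarrow> 'v \<Rightarrow> 'v) \<Rightarrow> ('a list \<Rightarrow> 'v::ab_group_add) \<Rightarrow> 'a list \<Rightarrow> 'v" where
  "covariant_diff D S w xs =
     (case xs of
        [x, x', x''] \<Rightarrow>
          (if {x, x', x''} \<subseteq> tvs_carrier D then
             (S x (w [x', x'']) - w [tlie_bracket D x x', x'']) +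
             (S x' (w [x'', x]) - w [tlie_bracket D x' x'', x]) +
             (S x'' (w [x, x']) - w [tlie_bracket D x'' x, x'])
           else 0)
      | _ \<Rightarrow> 0)"


section \<open>Crossed modules and their characteristic class\<close>

locale crossed_module =
  N: topological_lie_algebra scaleN bracketN + topological_lie_module scaleG bracketG scaleN act
  for scaleN :: "'k::topological_field_char_0 \<Rightarrow> 'n::{topological_ab_group_add, t2_space} \<Rightarrow> 'n"
    and bracketN :: "'n \<Rightarrow> 'n \<Rightarrow> 'n"
    and scaleG :: "'k \<Rightarrow> 'g::{topological_ab_group_add, t2_space} \<Rightarrow> 'g"
    and bracketG :: "'g \<Rightarrow> 'g \<Rightarrow> 'g"
    and act :: "'g \<Rightarrow> 'n \<Rightarrow> 'n" +
  fixes \<alpha> :: "'n \<Rightarrow> 'g"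
  assumes alpha_linear: "Vector_Spaces.linear scaleN scaleG \<alpha>"
    and alpha_bracket: "\<alpha> (bracketN h h') = bracketG (\<alpha> h) (\<alpha> h')"
    and alpha_continuous: "continuous_on UNIV \<alpha>"
    and alpha_act: "\<alpha> (act x h) = bracketG x (\<alpha> h)"
    and act_alpha: "act (\<alpha> h) h' = bracketN h h'"

abbreviation ker_alpha :: "('n \<Rightarrow> 'g::zero) \<Rightarrow> 'n set" where
  "ker_alpha \<alpha> \<equiv> {h. \<alpha> h = 0}"

text \<open>The last assumption says that \<open>\<alpha>\<close> is an extension of its image, equipped with the subspace
  topology, i.e. that it induces a topological isomorphism from the quotient by its kernel onto its
  image.  For general topological vector spaces this does not follow from the other two.\<close>

locale topologically_split_crossed_module =
  crossed_module scaleN bracketN scaleG bracketG act \<alpha>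
  for scaleN :: "'k::topological_field_char_0 \<Rightarrow> 'n::{topological_ab_group_add, t2_space} \<Rightarrow> 'n"
    and bracketN :: "'n \<Rightarrow> 'n \<Rightarrow> 'n"
    and scaleG :: "'k \<Rightarrow> 'g::{topological_ab_group_add, t2_space} \<Rightarrow> 'g"
    and bracketG :: "'g \<Rightarrow> 'g \<Rightarrow> 'g"
    and act :: "'g \<Rightarrow> 'n \<Rightarrow> 'n"
    and \<alpha> :: "'n \<Rightarrow> 'g" +
  assumes split_kernel: "topologically_split scaleN (ker_alpha \<alpha>)"
    and split_image: "topologically_split scaleG (range \<alpha>)"
    and extension: "quotient_map euclidean (top_of_set (range \<alpha>)) \<alpha>"

text \<open>The action of a coset on the kernel; independent of the representative, because the image of
  \<open>\<alpha>\<close> acts trivially on the kernel.\<close>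

definition quot_act :: "('g \<Rightarrow> 'n \<Rightarrow> 'n) \<Rightarrow> 'g set \<Rightarrow> 'n \<Rightarrow> 'n" where
  "quot_act act X z = act (SOME x. x \<in> X) z"

text \<open>\<open>\<phi>\<close> is an isomorphism of topological Lie algebras from the central extension of the image of
  \<open>\<alpha>\<close> by its kernel given by the cocycle \<open>f\<close>; it is the identity on the kernel and lies over
  the identity of the image.\<close>

definition central_extension_iso ::
  "('k \<Rightarrow> 'n::{ab_group_add, topological_space} \<Rightarrow> 'n) \<Rightarrow> ('n \<Rightarrow> 'n \<Rightarrow> 'n) \<Rightarrow>
   ('k \<Rightarrow> 'g::{ab_group_add, topological_space} \<Rightarrow> 'g) \<Rightarrow> ('g \<Rightarrow> 'g \<Rightarrow> 'g) \<Rightarrow>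
   ('n \<Rightarrow> 'g) \<Rightarrow> ('g list \<Rightarrow> 'n) \<Rightarrow> ('n \<times> 'g \<Rightarrow> 'n) \<Rightarrow> bool" where
  "central_extension_iso scaleN bracketN scaleG bracketG \<alpha> f \<phi> \<longleftrightarrow>
     homeomorphic_map
       (prod_topology (top_of_set (ker_alpha \<alpha>)) (top_of_set (range \<alpha>))) euclidean \<phi> \<and>
     (\<forall>z\<in>ker_alpha \<alpha>. \<forall>n\<in>range \<alpha>. \<forall>z'\<in>ker_alpha \<alpha>. \<forall>n'\<in>range \<alpha>.
        \<phi> (z + z', n + n') = \<phi> (z, n) + \<phi> (z', n') \<and>
        bracketN (\<phi> (z, n)) (\<phi> (z', n')) = \<phi> (f [n, n'], bracketG n n')) \<and>
     (\<forall>c. \<forall>z\<in>ker_alpha \<alpha>. \<forall>n\<in>range \<alpha>. \<phi> (scaleN c z, scaleG c n) = scaleN c (\<phi> (z, n))) \<and>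
     (\<forall>z\<in>ker_alpha \<alpha>. \<phi> (z, 0) = z) \<and>
     (\<forall>z\<in>ker_alpha \<alpha>. \<forall>n\<in>range \<alpha>. \<alpha> (\<phi> (z, n)) = n)"

definition characteristic_cocycle ::
  "('k \<Rightarrow> 'n::{ab_group_add, topological_space} \<Rightarrow> 'n) \<Rightarrow> ('n \<Rightarrow> 'n \<Rightarrow> 'n) \<Rightarrow>
   ('k \<Rightarrow> 'g::{ab_group_add, topological_space} \<Rightarrow> 'g) \<Rightarrow> ('g \<Rightarrow> 'g \<Rightarrow> 'g) \<Rightarrow>
   ('g \<Rightarrow> 'n \<Rightarrow> 'n) \<Rightarrow> ('n \<Rightarrow> 'g) \<Rightarrow> ('g set list \<Rightarrow> 'n) \<Rightarrow> bool" where
  "characteristic_cocycle scaleN bracketN scaleG bracketG act \<alpha> \<beta> \<longleftrightarrow>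
     (let \<nn> = range \<alpha>; \<zz> = ker_alpha \<alpha>;
          \<nn>_lie = sub_lie scaleG bracketG \<nn>;
          \<gg>hat = sub_lie scaleG bracketG UNIV;
          \<gg> = quot_lie scaleG bracketG \<nn>
      in \<beta> \<in> cocycles 3 \<gg> (quot_act act) scaleN \<zz> \<and>
         (\<exists>f \<phi> \<theta> f'.
            f \<in> cocycles 2 \<nn>_lie (\<lambda>_ _. 0) scaleN \<zz> \<and>
            central_extension_iso scaleN bracketN scaleG bracketG \<alpha> f \<phi> \<and>
            (\<forall>x. tvs_linear \<nn>_lie scaleN (\<theta> x)) \<and>
            (\<forall>n\<in>\<nn>. tvs_linear \<gg>hat scaleN (\<lambda>x. \<theta> x n)) \<and>
            continuous_map (prod_topology euclidean (top_of_set \<nn>)) (top_of_set \<zz>)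
              (\<lambda>(x, n). \<theta> x n) \<and>
            (\<forall>x. \<forall>z\<in>\<zz>. \<forall>n\<in>\<nn>. act x (\<phi> (z, n)) = \<phi> (act x z + \<theta> x n, bracketG x n)) \<and>
            f' \<in> cochains 2 \<gg>hat scaleN \<zz> \<and>
            (\<forall>x. \<forall>n\<in>\<nn>. f' [x, n] = \<theta> x n) \<and>
            lie_diff \<gg>hat act f' = (\<lambda>xs. \<beta> (map (coset \<nn>) xs))))"

definition characteristic_class ::
  "('k \<Rightarrow> 'n::{ab_group_add, topological_space} \<Rightarrow> 'n) \<Rightarrow> ('n \<Rightarrow> 'n \<Rightarrow> 'n) \<Rightarrow>
   ('k \<Rightarrow> 'g::{ab_group_add, topological_space} \<Rightarrow> 'g) \<Rightarrow> ('g \<Rightarrow> 'g \<Rightarrow> 'g) \<Rightarrow>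
   ('g \<Rightarrow> 'n \<Rightarrow> 'n) \<Rightarrow> ('n \<Rightarrow> 'g) \<Rightarrow> ('g set list \<Rightarrow> 'n) set" where
  "characteristic_class scaleN bracketN scaleG bracketG act \<alpha> =
     (THE c. \<exists>\<beta>. characteristic_cocycle scaleN bracketN scaleG bracketG act \<alpha> \<beta> \<and>
        c = cohomology_class 3 (quot_lie scaleG bracketG (range \<alpha>)) (quot_act act) scaleN
              (ker_alpha \<alpha>) \<beta>)"

end

theory Submission
  imports Defs
begin

text \<open>Let \<open>\<tau>\<close> be a continuous linear section of \<open>\<alpha>\<close> over its image and \<open>P(x) = \<tau>(x - \<sigma>(q(x)))\<close>.  Then
  \<open>f\<^sub>0 = dP - [P,P]/2 + q\<^sup>*\<omega>\<close> is an alternating form on the extended algebra with values in the kernel of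
  \<open>\<alpha>\<close>, it extends the form \<open>\<theta>\<close> belonging to \<open>\<tau>\<close>, and its differential is exactly the pullback of
  \<open>d\<^sub>S\<omega>\<close>.  Hence \<open>d\<^sub>S\<omega>\<close> is a cocycle and itself represents the characteristic class.  Any other
  extension \<open>f'\<close> of \<open>\<theta>\<close> differs from \<open>f\<^sub>0\<close> by a form that vanishes on the image of \<open>\<alpha>\<close> and so descends
  to the quotient, which makes the two representatives cohomologous.\<close>

subsection \<open>Cochains\<close>

text \<open>Since \<open>\<sigma> (q x) = x - \<alpha> (P x)\<close>, the map \<open>P\<close>
  behaves like a connection form: the outer action of \<open>q x\<close> is the action of
  \<open>x\<close> corrected by the inner derivation of \<open>P x\<close>, and the curvature of
  \<sigma> is, up to sign, \<alpha> applied to dP - [P,P]/2. This is why adding the pullback of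
  \<omega> gives values in the kernel. Once the terms in \<omega> are matched, what remains of the
  formula for the differential is the Bianchi identity of dP - [P,P]/2. The obstacle is that the
  characteristic class is a definite description over all presentations of the central extension,
  not over a single section. But d_S \<omega> does not involve \<tau>. Each presentation \<phi>
  yields a section \<open>\<phi> (0, n)\<close>, so the construction is run again with that section,
  and every representative is compared with the same cocycle. The section supplied by the splitting
  provides one representative. Elements of the quotient are cosets with a restricted carrier, so
  identities are checked on the extended algebra, whose carrier is the whole type, and moved down
  through \<open>q\<close> and \<sigma>.\<close>

lemma cochains_value:
  assumes "F \<in> cochains p D s V" "length xs = p" "set xs \<subseteq> tvs_carrier D"
  shows "F xs \<in> V"
  using assms unfolding cochains_def by blast

lemma cochains_outside:
  assumes "F \<in> cochains p D s V" "\<not> (length xs = p \<and> set xs \<subseteq> tvs_carrier D)"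
  shows "F xs = 0"
  using assms unfolding cochains_def by blast

lemma cochains_linear:
  assumes "F \<in> cochains p D s V" "length xs = p" "set xs \<subseteq> tvs_carrier D" "i < p"
  shows "tvs_linear D s (\<lambda>x. F (xs[i := x]))"
  using assms unfolding cochains_def by blast

lemma cochains_alternating:
  assumes "F \<in> cochains p D s V" "length xs = p" "set xs \<subseteq> tvs_carrier D" "\<not> distinct xs"
  shows "F xs = 0"
  using assms unfolding cochains_def by blast

text \<open>Turns continuity on a product of functions on \<open>{..<p}\<close> into continuity
  along arbitrary parameter maps. Points of the product are extensional, hence the restriction to
  \<open>{..<p}\<close> in the proof, which the list of values does not see.\<close>

lemma cochains_continuous:
  assumes F: "F \<in> cochains p D s V"
    and a: "\<And>i. i < p \<Longrightarrow> continuous_map T (tvs_top D) (a i)"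
  shows "continuous_map T (top_of_set V) (\<lambda>t. F (map (\<lambda>i. a i t) [0..<p]))"
proof -
  have "continuous_map T (product_topology (\<lambda>_. tvs_top D) {..<p}) (\<lambda>t. \<lambda>i\<in>{..<p}. a i t)"
    using a by (subst continuous_map_componentwise) auto
  moreover have "continuous_map (product_topology (\<lambda>_. tvs_top D) {..<p}) (top_of_set V)
      (\<lambda>v. F (map v [0..<p]))"
    using F unfolding cochains_def by blast
  ultimately have "continuous_map T (top_of_set V)
      ((\<lambda>v. F (map v [0..<p])) \<circ> (\<lambda>t. \<lambda>i\<in>{..<p}. a i t))"
    by (rule continuous_map_compose)
  moreover have "map (\<lambda>i\<in>{..<p}. a i t) [0..<p] = map (\<lambda>i. a i t) [0..<p]" for t
    by auto
  ultimately show ?thesis by (simp add: o_def)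
qed

lemma cochains_2_continuous:
  assumes F: "F \<in> cochains 2 D s V"
    and "continuous_map T (tvs_top D) a" "continuous_map T (tvs_top D) b"
  shows "continuous_map T (top_of_set V) (\<lambda>t. F [a t, b t])"
proof -
  have "continuous_map T (top_of_set V)
      (\<lambda>t. F (map (\<lambda>i. (if i = 0 then a else b) t) [0..<2]))"
    by (rule cochains_continuous[OF F]) (use assms in auto)
  then show ?thesis by (simp add: numeral_2_eq_2)
qed

lemma cochains_2_left:
  assumes F: "F \<in> cochains 2 D s V" and "y \<in> tvs_carrier D"
  shows "tvs_linear D s (\<lambda>x. F [x, y])"
  using cochains_linear[OF F, of "[y, y]" 0] assms(2) by simp

lemma cochains_2_right:
  assumes F: "F \<in> cochains 2 D s V" and "x \<in> tvs_carrier D"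
  shows "tvs_linear D s (\<lambda>y. F [x, y])"
  using cochains_linear[OF F, of "[x, x]" 1] assms(2) by simp

lemma cochains_2_self:
  assumes F: "F \<in> cochains 2 D s V" and "x \<in> tvs_carrier D"
  shows "F [x, x] = 0"
  using cochains_alternating[OF F, of "[x, x]"] assms(2) by simp

lemma length_2_cases:
  assumes "length xs = 2"
  obtains x y where "xs = [x, y]"
  using assms by (auto simp: numeral_2_eq_2 length_Suc_conv)

lemma length_3_cases:
  assumes "length xs = 3"
  obtains x y z where "xs = [x, y, z]"
  using assms by (auto simp: numeral_3_eq_3 length_Suc_conv)

lemma cochains_2I:
  assumes F0: "\<And>xs. \<not> (length xs = 2 \<and> set xs \<subseteq> tvs_carrier D) \<Longrightarrow> F xs = 0"
    and V: "\<And>x y. x \<in> tvs_carrier D \<Longrightarrow> y \<in> tvs_carrier D \<Longrightarrow> F [x, y] \<in> V"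
    and l: "\<And>y. y \<in> tvs_carrier D \<Longrightarrow> tvs_linear D s (\<lambda>x. F [x, y])"
    and r: "\<And>x. x \<in> tvs_carrier D \<Longrightarrow> tvs_linear D s (\<lambda>y. F [x, y])"
    and alt: "\<And>x. x \<in> tvs_carrier D \<Longrightarrow> F [x, x] = 0"
    and c: "continuous_map (prod_topology (tvs_top D) (tvs_top D)) (top_of_set V) (\<lambda>(x, y). F [x, y])"
  shows "F \<in> cochains 2 D s V"
proof -
  have "tvs_linear D s (\<lambda>x. F (xs[i := x]))"
    if "length xs = 2" "set xs \<subseteq> tvs_carrier D" "i < 2" for xs i
    using that l r by (cases i) (auto elim!: length_2_cases)
  moreover have "continuous_map (product_topology (\<lambda>_. tvs_top D) {..<2}) (top_of_set V)
       (\<lambda>v. F (map v [0..<2]))"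
  proof -
    have "continuous_map (product_topology (\<lambda>_. tvs_top D) {..<2::nat})
        (prod_topology (tvs_top D) (tvs_top D)) (\<lambda>v. (v 0, v 1))"
      by (intro continuous_map_pairedI continuous_map_product_projection) auto
    from continuous_map_compose[OF this c] show ?thesis
      by (simp add: o_def numeral_2_eq_2)
  qed
  ultimately show ?thesis
    unfolding cochains_def using F0 V alt by (auto elim!: length_2_cases)
qed

lemma cochains_3I:
  assumes F0: "\<And>xs. \<not> (length xs = 3 \<and> set xs \<subseteq> tvs_carrier D) \<Longrightarrow> F xs = 0"
    and V: "\<And>x y z. x \<in> tvs_carrier D \<Longrightarrow> y \<in> tvs_carrier D \<Longrightarrow> z \<in> tvs_carrier D \<Longrightarrow> F [x, y, z] \<in> V"
    and l: "\<And>y z. y \<in> tvs_carrier D \<Longrightarrow> z \<in> tvs_carrier D \<Longrightarrow> tvs_linear D s (\<lambda>x. F [x, y, z])"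
    and m: "\<And>x z. x \<in> tvs_carrier D \<Longrightarrow> z \<in> tvs_carrier D \<Longrightarrow> tvs_linear D s (\<lambda>y. F [x, y, z])"
    and r: "\<And>x y. x \<in> tvs_carrier D \<Longrightarrow> y \<in> tvs_carrier D \<Longrightarrow> tvs_linear D s (\<lambda>z. F [x, y, z])"
    and alt: "\<And>x y z. x \<in> tvs_carrier D \<Longrightarrow> y \<in> tvs_carrier D \<Longrightarrow> z \<in> tvs_carrier D \<Longrightarrow>
           x = y \<or> x = z \<or> y = z \<Longrightarrow> F [x, y, z] = 0"
    and c: "continuous_map (prod_topology (tvs_top D) (prod_topology (tvs_top D) (tvs_top D)))
              (top_of_set V) (\<lambda>(x, y, z). F [x, y, z])"
  shows "F \<in> cochains 3 D s V"
proof -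
  have "tvs_linear D s (\<lambda>x. F (xs[i := x]))"
    if xs: "length xs = 3" "set xs \<subseteq> tvs_carrier D" "i < 3" for xs i
  proof -
    from xs(3) consider "i = 0" | "i = 1" | "i = 2" by linarith
    then show ?thesis using xs l m r by cases (auto elim!: length_3_cases)
  qed
  moreover have "continuous_map (product_topology (\<lambda>_. tvs_top D) {..<3}) (top_of_set V)
       (\<lambda>v. F (map v [0..<3]))"
  proof -
    have "continuous_map (product_topology (\<lambda>_. tvs_top D) {..<3::nat})
        (prod_topology (tvs_top D) (prod_topology (tvs_top D) (tvs_top D))) (\<lambda>v. (v 0, v 1, v 2))"
      by (intro continuous_map_pairedI continuous_map_product_projection) auto
    from continuous_map_compose[OF this c] show ?thesis
      by (simp add: o_def numeral_3_eq_3 numeral_2_eq_2)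
  qed
  ultimately show ?thesis
    unfolding cochains_def using F0 V alt by (auto elim!: length_3_cases)
qed

lemma alt_sign_simps:
  "alt_sign 0 v = v" "alt_sign (Suc k) v = - alt_sign k v" "alt_sign k 0 = 0"
  by (simp_all add: alt_sign_def)

lemma lie_diff_3:
  assumes "{x, y, z} \<subseteq> tvs_carrier D"
  shows "lie_diff D a F [x, y, z] =
    a x (F [y, z]) - a y (F [x, z]) + a z (F [x, y])
    - F [tlie_bracket D x y, z] + F [tlie_bracket D x z, y] - F [tlie_bracket D y z, x]"
  using assms
  by (simp add: lie_diff_def alt_sign_simps nths_Cons lessThan_Suc numeral_eq_Suc algebra_simps)

lemma lie_diff_4:
  assumes "{x, y, z, w} \<subseteq> tvs_carrier D"
  shows "lie_diff D a F [x, y, z, w] =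
    a x (F [y, z, w]) - a y (F [x, z, w]) + a z (F [x, y, w]) - a w (F [x, y, z])
    - F [tlie_bracket D x y, z, w] + F [tlie_bracket D x z, y, w] - F [tlie_bracket D x w, y, z]
    - F [tlie_bracket D y z, x, w] + F [tlie_bracket D y w, x, z] - F [tlie_bracket D z w, x, y]"
  using assms
  by (simp add: lie_diff_def alt_sign_simps nths_Cons lessThan_Suc numeral_eq_Suc algebra_simps)

lemma lie_diff_outside:
  assumes F: "\<And>ys. length ys \<noteq> p \<Longrightarrow> F ys = 0" and a: "\<And>x. a x 0 = 0"
    and xs: "\<not> (length xs = Suc p \<and> set xs \<subseteq> tvs_carrier D)" and p: "0 < p"
  shows "lie_diff D a F xs = 0"
proof (cases "set xs \<subseteq> tvs_carrier D")
  case True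
  then have n: "length xs \<noteq> Suc p" using xs by blast
  have 1: "length (nths xs (- {j})) \<noteq> p" if "j < length xs" for j
  proof -
    have "{i. i < length xs \<and> i \<in> - {j}} = {..<length xs} - {j}" by auto
    then have "length (nths xs (- {j})) = length xs - 1"
      using that by (simp add: length_nths)
    with that n show ?thesis by auto
  qed
  have 2: "Suc (length (nths xs (- {i, j}))) \<noteq> p" if "j < length xs" "i < j" for i j
  proof -
    have "{k. k < length xs \<and> k \<in> - {i, j}} = {..<length xs} - {i, j}" by auto
    then have "length (nths xs (- {i, j})) = length xs - 2"
      using that by (simp add: length_nths card_Diff_subset)
    with that n show ?thesis by auto
  qed
  from 1 2 show ?thesis by (simp add: lie_diff_def F a alt_sign_simps)
qed (simp add: lie_diff_def)


section \<open>Operations on subalgebras, quotients and cosets\<close>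

lemma sub_lie_simps [simp]:
  "tvs_top (sub_lie s b A) = top_of_set A" "tvs_plus (sub_lie s b A) = (+)"
  "tvs_scale (sub_lie s b A) = s" "tlie_bracket (sub_lie s b A) = b"
  by (simp_all add: sub_lie_def)

lemma quot_lie_top [simp]: "tvs_top (quot_lie s b W) = quot_topology W"
  by (simp add: quot_lie_def)

lemma quot_tvs_simps:
  "tvs_top (quot_tvs s W) = quot_topology W"
  "tvs_plus (quot_tvs s W) = tvs_plus (quot_lie s b W)"
  "tvs_scale (quot_tvs s W) = tvs_scale (quot_lie s b W)"
  by (simp_all add: quot_tvs_def quot_lie_def tvs.truncate_def)

lemma coset_eq_iff:
  assumes "module.subspace s W" "Vector_Spaces.vector_space s"
  shows "coset W x = coset W y \<longleftrightarrow> x - y \<in> W"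
proof -
  interpret vector_space s by fact
  note S = assms(1)
  show ?thesis
  proof
    assume "coset W x = coset W y"
    moreover have "x \<in> coset W x" using subspace_0[OF S] by (force simp: coset_def)
    ultimately have "x \<in> coset W y" by simp
    then show "x - y \<in> W" by (auto simp: coset_def)
  next
    assume d: "x - y \<in> W"
    show "coset W x = coset W y"
    proof (intro subset_antisym subsetI)
      fix u assume "u \<in> coset W x"
      then obtain w where "w \<in> W" "u = y + ((x - y) + w)" by (auto simp: coset_def)
      then show "u \<in> coset W y" using subspace_add[OF S d] unfolding coset_def by blast
    next
      fix u assume "u \<in> coset W y"
      then obtain w where "w \<in> W" "u = x + (w - (x - y))" by (auto simp: coset_def)
      then show "u \<in> coset W x" using subspace_diff[OF S _ d] unfolding coset_def by blast
    qed
  qed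
qed

subsection \<open>Continuity of the operations\<close>

lemma continuous_map_binary:
  assumes "continuous_on UNIV (\<lambda>(x, y). f x y)"
    and "continuous_map T euclidean a" "continuous_map T euclidean b"
  shows "continuous_map T euclidean (\<lambda>t. f (a t) (b t))"
proof -
  have "continuous_map T euclidean (\<lambda>t. (a t, b t))"
    using continuous_map_pairedI[OF assms(2,3)] by simp
  moreover have "continuous_map euclidean euclidean (\<lambda>(x, y). f x y)"
    using assms(1) by simp
  ultimately have "continuous_map T euclidean ((\<lambda>(x, y). f x y) \<circ> (\<lambda>t. (a t, b t)))"
    by (rule continuous_map_compose)
  then show ?thesis by (simp add: o_def)
qed

lemma continuous_map_plus:
  fixes a b :: "'t \<Rightarrow> 'a :: topological_ab_group_add"
  assumes "continuous_map T euclidean a" "continuous_map T euclidean b"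
  shows "continuous_map T euclidean (\<lambda>t. a t + b t)"
  by (rule continuous_map_binary[OF _ assms]) (auto simp: case_prod_beta' intro!: continuous_intros)

lemma continuous_map_minus:
  fixes a b :: "'t \<Rightarrow> 'a :: topological_ab_group_add"
  assumes "continuous_map T euclidean a" "continuous_map T euclidean b"
  shows "continuous_map T euclidean (\<lambda>t. a t - b t)"
  by (rule continuous_map_binary[OF _ assms]) (auto simp: case_prod_beta' intro!: continuous_intros)

subsection \<open>Coboundaries form a group\<close>

lemma (in topological_vector_space) cochains_minus:
  assumes V: "subspace V" and F: "F \<in> cochains p D smul V" and G: "G \<in> cochains p D smul V"
  shows "(\<lambda>xs. F xs - G xs) \<in> cochains p D smul V"
proof -
  have lin: "tvs_linear D smul (\<lambda>x. F (xs[i := x]) - G (xs[i := x]))"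
    if "length xs = p" "set xs \<subseteq> tvs_carrier D" "i < p" for xs i
    using cochains_linear[OF F that] cochains_linear[OF G that]
    by (simp add: tvs_linear_def scale_right_diff_distrib)
  have "F xs - G xs \<in> V" if "length xs = p" "set xs \<subseteq> tvs_carrier D" for xs
    using cochains_value[OF F that] cochains_value[OF G that] by (rule subspace_diff[OF V])
  moreover have "continuous_map (product_topology (\<lambda>_. tvs_top D) {..<p}) (top_of_set V)
       (\<lambda>v. F (map v [0..<p]) - G (map v [0..<p]))"
  proof -
    have "continuous_map (product_topology (\<lambda>_. tvs_top D) {..<p}) (top_of_set V)
       (\<lambda>v. F (map v [0..<p]))" "continuous_map (product_topology (\<lambda>_. tvs_top D) {..<p}) (top_of_set V)
       (\<lambda>v. G (map v [0..<p]))"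
      using F G unfolding cochains_def by blast+
    then show ?thesis
      by (auto simp: continuous_map_in_subtopology Pi_iff image_subset_iff
          intro!: continuous_map_minus subspace_diff[OF V])
  qed
  ultimately show ?thesis
    using lin cochains_outside[OF F] cochains_outside[OF G]
      cochains_alternating[OF F] cochains_alternating[OF G]
    unfolding cochains_def by simp
qed

lemma lie_diff_minus:
  assumes a: "\<And>x u v. a x (u - v) = a x u - a x v"
  shows "lie_diff D a (\<lambda>xs. F xs - G xs) xs = lie_diff D a F xs - lie_diff D a G xs"
proof -
  have "alt_sign k (u - v) = alt_sign k u - alt_sign k v" for k and u v :: 'b
    by (simp add: alt_sign_def)
  then show ?thesis by (simp add: lie_diff_def a sum_subtractf)
qed

lemma (in topological_vector_space) coboundaries_minus:
  assumes "subspace V" "\<And>x u v. a x (u - v) = a x u - a x v"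
    and "F \<in> coboundaries (Suc p) D a smul V" "G \<in> coboundaries (Suc p) D a smul V"
  shows "(\<lambda>xs. F xs - G xs) \<in> coboundaries (Suc p) D a smul V"
proof -
  obtain F' G' where
    F': "F' \<in> cochains p D smul V" "F = lie_diff D a F'" and
    G': "G' \<in> cochains p D smul V" "G = lie_diff D a G'"
    using assms(3,4) by (auto simp: coboundaries_def)
  then have "(\<lambda>xs. F xs - G xs) = lie_diff D a (\<lambda>xs. F' xs - G' xs)"
    by (auto simp: lie_diff_minus[of a, OF assms(2)])
  with cochains_minus[OF assms(1) F'(1) G'(1)] show ?thesis
    by (auto simp: coboundaries_def)
qed

text \<open>Classes are sets of cocycles, so cohomologous cochains must give equal sets. Closure of
  coboundaries under differences yields zero first, then symmetry, then transitivity.\<close>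

lemma (in topological_vector_space) cohomology_class_eqI:
  assumes V: "subspace V" and a: "\<And>x u v. a x (u - v) = a x u - a x v"
    and FG: "(\<lambda>xs. F xs - G xs) \<in> coboundaries (Suc p) D a smul V"
  shows "cohomology_class (Suc p) D a smul V F = cohomology_class (Suc p) D a smul V G"
proof -
  note m = coboundaries_minus[OF V a]
  have "(\<lambda>xs. (F xs - G xs) - (F xs - G xs)) \<in> coboundaries (Suc p) D a smul V"
    by (rule m[OF FG FG])
  from m[OF this FG] have GF: "(\<lambda>xs. G xs - F xs) \<in> coboundaries (Suc p) D a smul V" by simp
  have "(\<lambda>xs. H xs - F xs) \<in> coboundaries (Suc p) D a smul V \<longleftrightarrow>
      (\<lambda>xs. H xs - G xs) \<in> coboundaries (Suc p) D a smul V" for H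
    using m[where F = "\<lambda>xs. H xs - F xs", OF _ GF] m[where F = "\<lambda>xs. H xs - G xs", OF _ FG] by auto
  then show ?thesis by (simp add: cohomology_class_def)
qed

subsection \<open>Algebra in a crossed module\<close>

lemma linear_simps:
  assumes "Vector_Spaces.linear s1 s2 f"
  shows "f (x + y) = f x + f y" "f (x - y) = f x - f y" "f (- x) = - f x" "f 0 = 0"
    "f (s1 c x) = s2 c (f x)"
  using assms[THEN module_hom_linearI]
  by (auto dest: module_hom.add module_hom.diff module_hom.neg module_hom.zero module_hom.scale)

lemma (in topological_lie_algebra) bracket_flip: "bracket x y = - bracket y x"
proof -
  have "0 = bracket (x + y) (x + y)" by (simp add: bracket_self)
  also have "\<dots> = bracket x y + bracket y x"
    unfolding linear_simps(1)[OF bracket_linear_left]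
    by (simp add: linear_simps(1)[OF bracket_linear_right] bracket_self)
  finally show ?thesis unfolding eq_neg_iff_add_eq_0 by (rule sym)
qed

text \<open>The Jacobi identity with the signs of \<open>lie_diff_3\<close>: the bracket terms of
  the differential cancel when the cochain is \<open>bracket\<close> itself.\<close>

lemma (in topological_lie_algebra) jacobi_left:
  "bracket (bracket x z) y = bracket (bracket x y) z + bracket (bracket y z) x"
proof -
  have "bracket (bracket x z) y = bracket y (bracket z x)"
    by (subst bracket_flip, subst bracket_flip[of x z]) (simp add: linear_simps[OF bracket_linear_right])
  also have "\<dots> = - (bracket z (bracket x y) + bracket x (bracket y z))"
    unfolding eq_neg_iff_add_eq_0 using jacobi[of y z x] by (simp only: add.assoc)
  also have "\<dots> = bracket (bracket x y) z + bracket (bracket y z) x"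
    using bracket_flip[of z "bracket x y"] bracket_flip[of x "bracket y z"] by simp
  finally show ?thesis .
qed

context crossed_module
begin

abbreviation "\<ff>\<zz> \<equiv> ker_alpha \<alpha>"
abbreviation "\<gg>hat \<equiv> sub_lie scaleG bracketG UNIV"
abbreviation "\<gg>quot \<equiv> quot_lie scaleG bracketG (range \<alpha>)"
abbreviation "q \<equiv> coset (range \<alpha>)"

lemmas act_left = linear_simps[OF act_linear_left]
  and act_right = linear_simps[OF act_linear_right]
  and brG_left = linear_simps[OF L.bracket_linear_left]
  and brG_right = linear_simps[OF L.bracket_linear_right]
  and brN_left = linear_simps[OF N.bracket_linear_left]
  and brN_right = linear_simps[OF N.bracket_linear_right]
  and alpha_simps = linear_simps[OF alpha_linear]

lemma subspace_image: "L.subspace (range \<alpha>)"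
proof (rule L.subspaceI)
  show "0 \<in> range \<alpha>" by (metis alpha_simps(4) rangeI)
  show "x + y \<in> range \<alpha>" if "x \<in> range \<alpha>" "y \<in> range \<alpha>" for x y
    using that by (auto simp flip: alpha_simps)
  show "scaleG c x \<in> range \<alpha>" if "x \<in> range \<alpha>" for c x
    using that by (auto simp flip: alpha_simps)
qed

lemma subspace_kernel: "N.subspace \<ff>\<zz>"
  unfolding N.subspace_def by (auto simp: alpha_simps)

lemma ideal_left: "w \<in> range \<alpha> \<Longrightarrow> bracketG x w \<in> range \<alpha>"
  by (auto simp flip: alpha_act)

lemma ideal_right: "w \<in> range \<alpha> \<Longrightarrow> bracketG w x \<in> range \<alpha>"
  using ideal_left[of w x] L.subspace_neg[OF subspace_image] L.bracket_flip[of w x] by simp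

lemma kernel_central: "z \<in> \<ff>\<zz> \<Longrightarrow> bracketN z h = 0" "z \<in> \<ff>\<zz> \<Longrightarrow> bracketN h z = 0"
proof -
  show "bracketN z h = 0" if "z \<in> \<ff>\<zz>" for z h
    using act_alpha[of z h] that by (simp add: act_left)
  then show "z \<in> \<ff>\<zz> \<Longrightarrow> bracketN h z = 0"
    using N.bracket_flip[of h z] by simp
qed

lemma act_kernel: "z \<in> \<ff>\<zz> \<Longrightarrow> act x z \<in> \<ff>\<zz>"
  by (simp add: alpha_act brG_right)

text \<open>The action is by derivations because \<open>bracketN h\<close> is the action of
  \<open>\<alpha> h\<close>: the module law for \<open>x\<close> and \<open>\<alpha> h\<close>,
  together with equivariance of \<alpha>, is the Leibniz rule.\<close>

lemma act_bracketN: "act x (bracketN h k) = bracketN (act x h) k + bracketN h (act x k)"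
proof -
  have "act x (act (\<alpha> h) k) = act (bracketG x (\<alpha> h)) k + act (\<alpha> h) (act x k)"
    by (simp add: act_bracket)
  then show ?thesis by (simp add: act_alpha flip: alpha_act)
qed

lemma q_eq_iff: "q x = q y \<longleftrightarrow> x - y \<in> range \<alpha>"
  by (rule coset_eq_iff[OF subspace_image L.vector_space_axioms])

lemma q_plus: "tvs_plus \<gg>quot (q x) (q y) = q (x + y)"
  by (rule L.quot_plus_coset[OF subspace_image])

lemma q_scale: "tvs_scale \<gg>quot c (q x) = q (scaleG c x)"
  by (rule L.quot_scale_coset[OF subspace_image])

lemma q_bracket: "tlie_bracket \<gg>quot (q x) (q y) = q (bracketG x y)"
  by (rule L.quot_bracket_coset[OF subspace_image ideal_left ideal_right])

lemma q_continuous: "continuous_map euclidean (quot_topology (range \<alpha>)) q"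
  by (rule quotient_imp_continuous_map[OF quotient_map_coset])

text \<open>The chosen representative differs from \<open>x\<close> by some
  \<open>\<alpha> h\<close>, which acts as the bracket with \<open>h\<close> and therefore kills the
  central element \<open>z\<close>.\<close>

lemma quot_act_q:
  assumes "z \<in> \<ff>\<zz>"
  shows "quot_act act (q x) z = act x z"
proof -
  have "x + \<alpha> 0 \<in> q x" unfolding coset_def by blast
  then have "(SOME y. y \<in> q x) \<in> q x" by (rule someI)
  then obtain h where "(SOME y. y \<in> q x) = x + \<alpha> h" by (auto simp: coset_def)
  then show ?thesis
    using assms by (simp add: quot_act_def act_left act_alpha kernel_central)
qed

lemmas cont_act = continuous_map_binary[OF continuous_act]
  and cont_brG = continuous_map_binary[OF L.continuous_bracket]
  and cont_brN = continuous_map_binary[OF N.continuous_bracket]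

subsection \<open>The differential on \<open>2\<close>-cochains of the extended algebra\<close>

lemma cochain_hat_simps:
  assumes "F \<in> cochains 2 \<gg>hat scaleN V"
  shows "F [x + x', y] = F [x, y] + F [x', y]" "F [y, x + x'] = F [y, x] + F [y, x']"
    "F [scaleG c x, y] = scaleN c (F [x, y])" "F [y, scaleG c x] = scaleN c (F [y, x])"
    "F [x, x] = 0"
  using cochains_2_left[OF assms, of y] cochains_2_right[OF assms, of y] cochains_2_self[OF assms]
  by (auto simp: tvs_linear_def)

lemma cochain_hat_simps':
  assumes F: "F \<in> cochains 2 \<gg>hat scaleN V"
  shows "F [0, y] = 0" "F [y, 0] = 0" "F [- x, y] = - F [x, y]" "F [y, - x] = - F [y, x]"
    "F [x - x', y] = F [x, y] - F [x', y]" "F [y, x - x'] = F [y, x] - F [y, x']"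
proof -
  note a = cochain_hat_simps[OF F]
  show 0: "F [0, y] = 0" "F [y, 0] = 0" for y
    using a(1)[of 0 0 y] a(2)[of y 0 0] by simp_all
  show m: "F [- x, y] = - F [x, y]" "F [y, - x] = - F [y, x]" for x y
    using a(1)[of x "- x" y] a(2)[of y x "- x"] by (simp_all add: 0 eq_neg_iff_add_eq_0 add.commute)
  show "F [x - x', y] = F [x, y] - F [x', y]" "F [y, x - x'] = F [y, x] - F [y, x']"
    using a(1)[of x "- x'" y] a(2)[of y x "- x'"] by (simp_all add: m)
qed

lemma cochain_hat_flip:
  assumes F: "F \<in> cochains 2 \<gg>hat scaleN V"
  shows "F [x, y] = - F [y, x]"
proof -
  have "0 = F [x + y, x + y]" by (simp add: cochain_hat_simps[OF F])
  also have "\<dots> = F [x, y] + F [y, x]"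
    unfolding cochain_hat_simps(1)[OF F] by (simp add: cochain_hat_simps(2,5)[OF F])
  finally show ?thesis unfolding eq_neg_iff_add_eq_0 by (rule sym)
qed

text \<open>Antisymmetry absorbs the alternating signs, giving the cyclic shape in which
  \<open>covariant_diff\<close> is written, so that the two can be compared term by term.\<close>

lemma lie_diff_hat_cyclic:
  assumes F: "F \<in> cochains 2 \<gg>hat scaleN V"
  shows "lie_diff \<gg>hat act F [x, y, z] =
    (act x (F [y, z]) - F [bracketG x y, z]) + (act y (F [z, x]) - F [bracketG y z, x])
    + (act z (F [x, y]) - F [bracketG z x, y])"
proof -
  have "F [x, z] = - F [z, x]" by (rule cochain_hat_flip[OF F])
  moreover have "F [bracketG x z, y] = - F [bracketG z x, y]"
    by (subst L.bracket_flip) (simp add: cochain_hat_simps'[OF F])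
  ultimately show ?thesis by (simp add: lie_diff_3 act_right)
qed

lemma lie_diff_hat_outside:
  assumes F: "F \<in> cochains p \<gg>hat scaleN V" and "length xs \<noteq> Suc p" "0 < p"
  shows "lie_diff \<gg>hat act F xs = 0"
  using assms cochains_outside[OF F]
  by (intro lie_diff_outside[of p]) (auto simp: act_right)

lemma lie_diff_hat_cochains:
  assumes F: "F \<in> cochains 2 \<gg>hat scaleN \<ff>\<zz>"
  shows "lie_diff \<gg>hat act F \<in> cochains 3 \<gg>hat scaleN \<ff>\<zz>"
proof (rule cochains_3I)
  fix xs assume "\<not> (length xs = 3 \<and> set xs \<subseteq> tvs_carrier \<gg>hat)"
  then show "lie_diff \<gg>hat act F xs = 0"
    by (intro lie_diff_hat_outside[OF F]) auto
next
  have Z: "F [x, y] \<in> \<ff>\<zz>" for x y by (rule cochains_value[OF F]) auto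
  show Z3: "lie_diff \<gg>hat act F [x, y, z] \<in> \<ff>\<zz>" for x y z
    unfolding lie_diff_hat_cyclic[OF F]
    by (intro N.subspace_add[OF subspace_kernel] N.subspace_diff[OF subspace_kernel] act_kernel Z)
  show "tvs_linear \<gg>hat scaleN (\<lambda>x. lie_diff \<gg>hat act F [x, y, z])" for y z
    by (simp add: tvs_linear_def lie_diff_hat_cyclic[OF F] cochain_hat_simps[OF F] act_left act_right
        brG_left brG_right N.scale_right_distrib N.scale_right_diff_distrib)
  show "tvs_linear \<gg>hat scaleN (\<lambda>x. lie_diff \<gg>hat act F [y, x, z])" for y z
    by (simp add: tvs_linear_def lie_diff_hat_cyclic[OF F] cochain_hat_simps[OF F] act_left act_right
        brG_left brG_right N.scale_right_distrib N.scale_right_diff_distrib)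
  show "tvs_linear \<gg>hat scaleN (\<lambda>x. lie_diff \<gg>hat act F [y, z, x])" for y z
    by (simp add: tvs_linear_def lie_diff_hat_cyclic[OF F] cochain_hat_simps[OF F] act_left act_right
        brG_left brG_right N.scale_right_distrib N.scale_right_diff_distrib)
  \<comment> \<open>With a repeated argument every term either vanishes or cancels against another
    one by antisymmetry.\<close>
  have flip: "F [bracketG a b, c] = - F [bracketG b a, c]" for a b c
    by (subst L.bracket_flip) (simp add: cochain_hat_simps'[OF F])
  fix x y z :: 'g
  have "lie_diff \<gg>hat act F [a, a, b] = 0" "lie_diff \<gg>hat act F [a, b, a] = 0"
    "lie_diff \<gg>hat act F [b, a, a] = 0" for a b
    using cochain_hat_flip[OF F, of a b] flip[of a b a]
    by (simp_all add: lie_diff_hat_cyclic[OF F] cochain_hat_simps(5)[OF F]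
        cochain_hat_simps'(1)[OF F] L.bracket_self act_right)
  then show "lie_diff \<gg>hat act F [x, y, z] = 0" if "x = y \<or> x = z \<or> y = z"
    using that by blast
next
  have c: "continuous_map T euclidean (\<lambda>t. F [a t, b t])"
    if "continuous_map T euclidean a" "continuous_map T euclidean b" for T :: "'t topology" and a b
    using cochains_2_continuous[OF F, of T a b] that by (simp add: continuous_map_in_subtopology)
  have Z: "F [x, y] \<in> \<ff>\<zz>" for x y by (rule cochains_value[OF F]) auto
  have Z3: "lie_diff \<gg>hat act F [x, y, z] \<in> \<ff>\<zz>" for x y z
    unfolding lie_diff_hat_cyclic[OF F]
    by (intro N.subspace_add[OF subspace_kernel] N.subspace_diff[OF subspace_kernel] act_kernel Z)
  have p: "continuous_map euclidean euclidean (\<lambda>t :: 'g \<times> 'g \<times> 'g. fst t)"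
    "continuous_map euclidean euclidean (\<lambda>t :: 'g \<times> 'g \<times> 'g. fst (snd t))"
    "continuous_map euclidean euclidean (\<lambda>t :: 'g \<times> 'g \<times> 'g. snd (snd t))"
    by (auto intro!: continuous_intros)
  have "continuous_map euclidean euclidean
      (\<lambda>t :: 'g \<times> 'g \<times> 'g. lie_diff \<gg>hat act F [fst t, fst (snd t), snd (snd t)])"
    unfolding lie_diff_hat_cyclic[OF F]
    by (intro continuous_map_plus continuous_map_minus c cont_act cont_brG p)
  then show "continuous_map
      (prod_topology (tvs_top \<gg>hat) (prod_topology (tvs_top \<gg>hat) (tvs_top \<gg>hat)))
      (top_of_set \<ff>\<zz>) (\<lambda>(x, y, z). lie_diff \<gg>hat act F [x, y, z])"
    using Z3 by (auto simp: continuous_map_in_subtopology case_prod_beta')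
qed

text \<open>Double actions cancel by the module law, doubly nested brackets by Jacobi, and terms
  with two separate brackets by antisymmetry of \<open>F\<close>. Jacobi is instantiated once for
  each of the four triples and antisymmetry once for each of the three splittings into two pairs,
  since the general flip rule would rewrite forever.\<close>

lemma lie_diff_lie_diff_hat:
  assumes F: "F \<in> cochains 2 \<gg>hat scaleN \<ff>\<zz>"
  shows "lie_diff \<gg>hat act (lie_diff \<gg>hat act F) xs = 0"
proof (cases "length xs = 4")
  case False
  then show ?thesis using lie_diff_hat_outside[OF lie_diff_hat_cochains[OF F]] by simp
next
  case True
  then obtain x y z w where xs: "xs = [x, y, z, w]"
    by (auto simp: numeral_eq_Suc length_Suc_conv)
  have j: "F [bracketG (bracketG b c) a, d] =
      F [bracketG (bracketG a c) b, d] - F [bracketG (bracketG a b) c, d]" for a b c d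
  proof -
    have "bracketG (bracketG b c) a = bracketG (bracketG b a) c + bracketG (bracketG a c) b"
      by (rule L.jacobi_left)
    also have "bracketG b a = - bracketG a b" by (rule L.bracket_flip)
    finally show ?thesis by (simp add: brG_left cochain_hat_simps[OF F] cochain_hat_simps'[OF F])
  qed
  note f = cochain_hat_flip[OF F]
  show ?thesis unfolding xs
    by (simp add: lie_diff_4 lie_diff_3 act_right act_bracket
        j[of y z x] j[of y w x] j[of z w x] j[of z w y]
        f[of "bracketG z w" "bracketG x y"] f[of "bracketG y w" "bracketG x z"]
        f[of "bracketG y z" "bracketG x w"])
qed


subsection \<open>Descent of cochains along a section\<close>

lemma quot_act_minus: "quot_act act X (u - v) = quot_act act X u - quot_act act X v"
  by (simp add: quot_act_def act_right)

lemma lists_quot: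
  assumes "set Xs \<subseteq> range q"
  obtains xs where "Xs = map q xs"
proof -
  have "map q (map (inv q) Xs) = Xs"
    using assms by (simp add: subset_iff f_inv_into_f map_idI)
  then show ?thesis using that by metis
qed

lemma cochains_value_subspace: "F \<in> cochains p D scaleN \<ff>\<zz> \<Longrightarrow> F xs \<in> \<ff>\<zz>"
  using cochains_value cochains_outside N.subspace_0[OF subspace_kernel] by metis

text \<open>Pullback along \<open>q\<close> is a chain map because \<open>q\<close> respects
  brackets. The values are taken in the kernel since there the action of a coset agrees with that of
  any representative.\<close>

lemma lie_diff_quot:
  assumes F: "\<And>Xs. F Xs \<in> \<ff>\<zz>"
  shows "lie_diff \<gg>quot (quot_act act) F (map q xs) = lie_diff \<gg>hat act (\<lambda>xs. F (map q xs)) xs"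
proof -
  have "set (map q xs) \<subseteq> tvs_carrier \<gg>quot" by (auto simp: topspace_quot_topology)
  then show ?thesis
    by (simp add: lie_diff_def nths_map quot_act_q[OF F] q_bracket)
qed

lemma tvs_linear_quot: "tvs_linear \<gg>quot scaleN f \<longleftrightarrow> tvs_linear \<gg>hat scaleN (\<lambda>x. f (q x))"
  by (simp add: tvs_linear_def topspace_quot_topology q_plus q_scale)

lemma cochains_pullback:
  assumes F: "F \<in> cochains 2 \<gg>quot scaleN V"
  shows "(\<lambda>xs. F (map q xs)) \<in> cochains 2 \<gg>hat scaleN V"
proof (rule cochains_2I)
  have c: "q x \<in> tvs_carrier \<gg>quot" for x by (simp add: topspace_quot_topology)
  show "F (map q xs) = 0" if "\<not> (length xs = 2 \<and> set xs \<subseteq> tvs_carrier \<gg>hat)" for xs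
    by (rule cochains_outside[OF F]) (use that in auto)
  show "F (map q [x, y]) \<in> V" for x y
    by (rule cochains_value[OF F]) (auto simp: topspace_quot_topology)
  show "tvs_linear \<gg>hat scaleN (\<lambda>x. F (map q [x, y]))" for y
    using cochains_2_left[OF F c] by (simp add: tvs_linear_quot)
  show "tvs_linear \<gg>hat scaleN (\<lambda>y. F (map q [x, y]))" for x
    using cochains_2_right[OF F c] by (simp add: tvs_linear_quot)
  show "F (map q [x, x]) = 0" for x
    using cochains_2_self[OF F c] by simp
  have "continuous_map euclidean (tvs_top \<gg>quot) (\<lambda>t :: 'g \<times> 'g. q (fst t))"
    "continuous_map euclidean (tvs_top \<gg>quot) (\<lambda>t :: 'g \<times> 'g. q (snd t))"
    using continuous_map_compose[OF _ q_continuous, of euclidean fst]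
      continuous_map_compose[OF _ q_continuous, of euclidean snd]
    by (simp_all add: o_def continuous_on_fst continuous_on_snd continuous_on_id)
  from cochains_2_continuous[OF F this]
  show "continuous_map (prod_topology (tvs_top \<gg>hat) (tvs_top \<gg>hat)) (top_of_set V)
     (\<lambda>(x, y). F (map q [x, y]))"
    by (simp add: case_prod_beta')
qed

end

section \<open>Continuous linear sections of the quotient map, and descent along them\<close>

locale crossed_module_section =
  crossed_module scaleN bracketN scaleG bracketG act \<alpha>
  for scaleN :: "'k::topological_field_char_0 \<Rightarrow> 'n::{topological_ab_group_add, t2_space} \<Rightarrow> 'n"
    and bracketN :: "'n \<Rightarrow> 'n \<Rightarrow> 'n"
    and scaleG :: "'k \<Rightarrow> 'g::{topological_ab_group_add, t2_space} \<Rightarrow> 'g"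
    and bracketG :: "'g \<Rightarrow> 'g \<Rightarrow> 'g"
    and act :: "'g \<Rightarrow> 'n \<Rightarrow> 'n"
    and \<alpha> :: "'n \<Rightarrow> 'g" +
  fixes \<sigma> :: "'g set \<Rightarrow> 'g"
  assumes is_section: "continuous_linear_section scaleG (range \<alpha>) \<sigma>"
begin

lemma section_continuous: "continuous_map (quot_topology (range \<alpha>)) euclidean \<sigma>"
  using is_section by (simp add: continuous_linear_section_def)

lemma q_section: "X \<in> range q \<Longrightarrow> q (\<sigma> X) = X"
  using is_section by (auto simp: continuous_linear_section_def)

lemma section_linear:
  "\<sigma> (q (x + y)) = \<sigma> (q x) + \<sigma> (q y)" "\<sigma> (q (scaleG c x)) = scaleG c (\<sigma> (q x))"
proof -
  have l: "tvs_linear (quot_tvs scaleG (range \<alpha>)) scaleG \<sigma>"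
    using is_section by (simp add: continuous_linear_section_def)
  have c: "q x \<in> tvs_carrier (quot_tvs scaleG (range \<alpha>))" for x
    by (simp add: quot_tvs_simps topspace_quot_topology)
  show "\<sigma> (q (x + y)) = \<sigma> (q x) + \<sigma> (q y)"
    using l c unfolding tvs_linear_def quot_tvs_simps(1) quot_tvs_simps(2,3)[where b = bracketG] q_plus[symmetric] by blast
  show "\<sigma> (q (scaleG c x)) = scaleG c (\<sigma> (q x))"
    using l c unfolding tvs_linear_def quot_tvs_simps(1) quot_tvs_simps(2,3)[where b = bracketG] q_scale[symmetric] by blast
qed

lemma section_0: "\<sigma> (q 0) = 0"
  using section_linear(1)[of 0 0] by simp

lemma section_image: "n \<in> range \<alpha> \<Longrightarrow> \<sigma> (q n) = 0"
  using section_0 q_eq_iff[of n 0] by simp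

lemma minus_section: "x - \<sigma> (q x) \<in> range \<alpha>"
  by (simp add: q_section flip: q_eq_iff)

lemma section_q_continuous:
  "continuous_map T euclidean a \<Longrightarrow> continuous_map T euclidean (\<lambda>t. \<sigma> (q (a t)))"
  using continuous_map_compose[OF continuous_map_compose[OF _ q_continuous] section_continuous]
  by (fastforce simp: o_def)

text \<open>On cosets, \<open>F\<close> equals its pullback evaluated at the lifts under \<sigma>.
  So continuity of \<sigma> gives continuity of \<open>F\<close>, and surjectivity of
  \<open>q\<close> gives multilinearity.\<close>

lemma cochains_descend:
  assumes F0: "\<And>Xs. \<not> (length Xs = p \<and> set Xs \<subseteq> tvs_carrier \<gg>quot) \<Longrightarrow> F Xs = 0"
    and F: "(\<lambda>xs. F (map q xs)) \<in> cochains p \<gg>hat scaleN V"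
  shows "F \<in> cochains p \<gg>quot scaleN V"
proof -
  let ?F = "\<lambda>xs. F (map q xs)"
  have "F Xs \<in> V \<and> (\<forall>i<p. tvs_linear \<gg>quot scaleN (\<lambda>X. F (Xs[i := X]))) \<and>
      (\<not> distinct Xs \<longrightarrow> F Xs = 0)"
    if "length Xs = p" "set Xs \<subseteq> tvs_carrier \<gg>quot" for Xs
  proof -
    from that(2) have "map q (map \<sigma> Xs) = Xs"
      by (intro nth_equalityI) (auto simp: topspace_quot_topology subset_iff q_section)
    \<comment> \<open>Lifting by \<sigma>, and not by arbitrary representatives, sends equal cosets
      to equal elements, so a repetition in \<open>Xs\<close> survives.\<close>
    then obtain xs where xs: "Xs = map q xs" "xs = map \<sigma> Xs" by metis
    have l: "length xs = p" using xs that by simp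
    have "tvs_linear \<gg>quot scaleN (\<lambda>X. F (Xs[i := X]))" if "i < p" for i
      using cochains_linear[OF F l _ that] by (simp add: tvs_linear_quot xs(1) map_update)
    moreover have "F Xs = 0" if "\<not> distinct Xs"
    proof -
      have "\<not> distinct xs" using that by (subst xs(2)) (simp add: distinct_map)
      from cochains_alternating[OF F l _ this] show ?thesis by (simp add: xs(1))
    qed
    ultimately show ?thesis using cochains_value[OF F l] by (simp add: xs(1))
  qed
  moreover have "continuous_map (product_topology (\<lambda>_. tvs_top \<gg>quot) {..<p}) (top_of_set V)
      (\<lambda>v. F (map v [0..<p]))"
  proof -
    have "continuous_map (product_topology (\<lambda>_. tvs_top \<gg>quot) {..<p}) (tvs_top \<gg>hat)
        (\<lambda>v. \<sigma> (v i))" if "i < p" for i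
    proof -
      have "continuous_map (product_topology (\<lambda>_. tvs_top \<gg>quot) {..<p})
          (quot_topology (range \<alpha>)) (\<lambda>v. v i)"
        using continuous_map_product_projection[of i "{..<p}" "\<lambda>_. tvs_top \<gg>quot"] that by simp
      from continuous_map_compose[OF this section_continuous] show ?thesis
        by (simp add: o_def)
    qed
    then have *: "continuous_map (product_topology (\<lambda>_. tvs_top \<gg>quot) {..<p}) (top_of_set V)
        (\<lambda>v. ?F (map (\<lambda>i. \<sigma> (v i)) [0..<p]))"
      by (rule cochains_continuous[OF F])
    have "map q (map (\<lambda>i. \<sigma> (v i)) [0..<p]) = map v [0..<p]"
      if "v \<in> topspace (product_topology (\<lambda>_. tvs_top \<gg>quot) {..<p})" for v
      using that by (auto simp: topspace_quot_topology PiE_iff intro!: q_section)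
    then show ?thesis by (intro continuous_map_eq[OF *]) metis
  qed
  ultimately show ?thesis unfolding cochains_def using F0 by blast
qed

end

subsection \<open>The cochain attached to a section of \<open>\<alpha>\<close>\<close>

text \<open>The section \<tau> is kept abstract because two kinds are used: one built from the
  splitting of the kernel, and one extracted from an arbitrary presentation of the central
  extension.\<close>

locale crossed_module_lift =
  crossed_module_section scaleN bracketN scaleG bracketG act \<alpha> \<sigma>
  for scaleN :: "'k::topological_field_char_0 \<Rightarrow> 'n::{topological_ab_group_add, t2_space} \<Rightarrow> 'n"
    and bracketN :: "'n \<Rightarrow> 'n \<Rightarrow> 'n"
    and scaleG :: "'k \<Rightarrow> 'g::{topological_ab_group_add, t2_space} \<Rightarrow> 'g"
    and bracketG :: "'g \<Rightarrow> 'g \<Rightarrow> 'g"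
    and act :: "'g \<Rightarrow> 'n \<Rightarrow> 'n"
    and \<alpha> :: "'n \<Rightarrow> 'g"
    and \<sigma> :: "'g set \<Rightarrow> 'g" +
  fixes \<omega> :: "'g set list \<Rightarrow> 'n" and \<tau> :: "'g \<Rightarrow> 'n"
  assumes omega: "\<omega> \<in> cochains 2 (quot_lie scaleG bracketG (range \<alpha>)) scaleN UNIV"
    and curvature: "bracketG (\<sigma> (coset (range \<alpha>) x)) (\<sigma> (coset (range \<alpha>) y))
        - \<sigma> (coset (range \<alpha>) (bracketG x y)) = \<alpha> (\<omega> [coset (range \<alpha>) x, coset (range \<alpha>) y])"
    and tau_linear: "tvs_linear (sub_lie scaleG bracketG (range \<alpha>)) scaleN \<tau>"
    and tau_continuous: "continuous_map (top_of_set (range \<alpha>)) euclidean \<tau>"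
    and alpha_tau: "n \<in> range \<alpha> \<Longrightarrow> \<alpha> (\<tau> n) = n"
begin

lemma tau_simps:
  assumes "m \<in> range \<alpha>" "n \<in> range \<alpha>"
  shows "\<tau> (m + n) = \<tau> m + \<tau> n" "\<tau> (scaleG c m) = scaleN c (\<tau> m)"
  using assms tau_linear by (auto simp: tvs_linear_def)

lemma tau_0: "\<tau> 0 = 0"
  using tau_simps(1)[of 0 0] L.subspace_0[OF subspace_image] by simp

text \<open>The projection onto the image of \<alpha> along the complement chosen by \<sigma>,
  lifted through \<tau>.\<close>

definition P :: "'g \<Rightarrow> 'n" where
  "P x = \<tau> (x - \<sigma> (q x))"

lemma P_simps: "P (x + y) = P x + P y" "P (scaleG c x) = scaleN c (P x)"
proof -
  have "x + y - \<sigma> (q (x + y)) = (x - \<sigma> (q x)) + (y - \<sigma> (q y))"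
    by (simp add: section_linear)
  then show "P (x + y) = P x + P y"
    unfolding P_def using tau_simps(1)[OF minus_section minus_section] by metis
  have "scaleG c x - \<sigma> (q (scaleG c x)) = scaleG c (x - \<sigma> (q x))"
    by (simp add: section_linear L.scale_right_diff_distrib)
  then show "P (scaleG c x) = scaleN c (P x)"
    unfolding P_def using tau_simps(2)[OF minus_section minus_section] by metis
qed

lemma P_0: "P 0 = 0"
  using P_simps(1)[of 0 0] by simp

lemma P_uminus: "P (- x) = - P x"
  using P_simps(1)[of x "- x"] by (simp add: P_0 eq_neg_iff_add_eq_0 add.commute)

lemma P_image: "n \<in> range \<alpha> \<Longrightarrow> P n = \<tau> n"
  by (simp add: P_def section_image)

lemma alpha_P: "\<alpha> (P x) = x - \<sigma> (q x)"
  unfolding P_def by (rule alpha_tau[OF minus_section])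

lemma cont_P:
  assumes "continuous_map T euclidean a"
  shows "continuous_map T euclidean (\<lambda>t. P (a t))"
proof -
  have "continuous_map T (top_of_set (range \<alpha>)) (\<lambda>t. a t - \<sigma> (q (a t)))"
    using assms minus_section
    by (simp add: continuous_map_in_subtopology image_subset_iff Pi_iff
        continuous_map_minus section_q_continuous)
  from continuous_map_compose[OF this tau_continuous] show ?thesis
    by (simp add: o_def P_def)
qed

text \<open>The formula of a covariant derivative: the outer action is the action of
  \<open>x\<close> twisted by the connection form \<open>P\<close>.\<close>

lemma section_act: "act (\<sigma> (q x)) h = act x h - bracketN (P x) h"
proof -
  have "\<sigma> (q x) = x - \<alpha> (P x)" by (simp add: alpha_P)
  then show ?thesis by (simp add: act_left act_alpha)
qed

abbreviation "\<Omega> xs \<equiv> \<omega> (map q xs)"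

lemma omega_pullback: "\<Omega> \<in> cochains 2 \<gg>hat scaleN UNIV"
  by (rule cochains_pullback[OF omega])

lemmas Omega_simps = cochain_hat_simps[OF omega_pullback, simplified list.map]
  and Omega_simps' = cochain_hat_simps'[OF omega_pullback, simplified list.map]

text \<open>Substituting \<open>\<sigma> (q z) = z - \<alpha> (P z)\<close> in the curvature cancels
  \<open>bracketG x y\<close> and leaves only values of \<alpha>. This is what puts
  \<open>f\<^sub>0\<close> into the kernel.\<close>

lemma alpha_omega:
  "\<alpha> (\<omega> [q x, q y]) = \<alpha> (act y (P x) - act x (P y) + bracketN (P x) (P y) + P (bracketG x y))"
proof -
  have s: "\<sigma> (q z) = z - \<alpha> (P z)" for z by (simp add: alpha_P)
  have "bracketG (\<alpha> (P x)) y = - bracketG y (\<alpha> (P x))" by (rule L.bracket_flip)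
  then show ?thesis
    unfolding curvature[symmetric] s
    by (simp add: brG_left brG_right alpha_simps alpha_act alpha_bracket)
qed

text \<open>The form [P,P]/2 at (x, y) is just \<open>bracketN (P x) (P y)\<close>, since the two
  orders of the arguments contribute equally.\<close>

definition f\<^sub>0 :: "'g list \<Rightarrow> 'n" where
  "f\<^sub>0 xs = (if length xs = 2 then
     let x = xs ! 0; y = xs ! 1 in
     act x (P y) - act y (P x) - P (bracketG x y) - bracketN (P x) (P y) + \<omega> [q x, q y]
   else 0)"

lemma f0_pair:
  "f\<^sub>0 [x, y] = act x (P y) - act y (P x) - P (bracketG x y) - bracketN (P x) (P y) + \<omega> [q x, q y]"
  by (simp add: f\<^sub>0_def)

lemma f0_cochain: "f\<^sub>0 \<in> cochains 2 \<gg>hat scaleN \<ff>\<zz>"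
proof (rule cochains_2I)
  show "f\<^sub>0 xs = 0" if "\<not> (length xs = 2 \<and> set xs \<subseteq> tvs_carrier \<gg>hat)" for xs
    using that by (simp add: f\<^sub>0_def)
  show Z: "f\<^sub>0 [x, y] \<in> \<ff>\<zz>" for x y
    by (simp add: f0_pair alpha_simps alpha_omega)
  show "tvs_linear \<gg>hat scaleN (\<lambda>x. f\<^sub>0 [x, y])" for y
    by (simp add: tvs_linear_def f0_pair Omega_simps act_left act_right brG_left brN_left P_simps
        N.scale_right_distrib N.scale_right_diff_distrib)
  show "tvs_linear \<gg>hat scaleN (\<lambda>x. f\<^sub>0 [y, x])" for y
    by (simp add: tvs_linear_def f0_pair Omega_simps act_left act_right brG_right brN_right P_simps
        N.scale_right_distrib N.scale_right_diff_distrib)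
  show "f\<^sub>0 [x, x] = 0" for x
    by (simp add: f0_pair Omega_simps L.bracket_self N.bracket_self P_0)
  have f: "continuous_map euclidean euclidean (\<lambda>t :: 'g \<times> 'g. fst t)"
    and s: "continuous_map euclidean euclidean (\<lambda>t :: 'g \<times> 'g. snd t)"
    by (auto intro!: continuous_intros)
  have o: "continuous_map euclidean euclidean (\<lambda>t :: 'g \<times> 'g. \<omega> [q (fst t), q (snd t)])"
    using cochains_2_continuous[OF omega_pullback, of euclidean fst snd] f s by simp
  have "continuous_map euclidean euclidean (\<lambda>t. f\<^sub>0 [fst t, snd t])"
    unfolding f0_pair
    by (intro continuous_map_plus continuous_map_minus cont_act cont_brG cont_brN cont_P o f s)
  then show "continuous_map (prod_topology (tvs_top \<gg>hat) (tvs_top \<gg>hat)) (top_of_set \<ff>\<zz>)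
      (\<lambda>(x, y). f\<^sub>0 [x, y])"
    using Z by (auto simp: continuous_map_in_subtopology case_prod_beta')
qed

text \<open>On the image \<open>P\<close> is \<tau> and the term in \<omega> vanishes. As
  \<open>n\<close> acts like the bracket with \<open>\<tau> n\<close>, the terms
  \<open>act n (P x)\<close> and \<open>bracketN (P x) (\<tau> n)\<close> cancel.\<close>

lemma f0_image:
  assumes "n \<in> range \<alpha>"
  shows "f\<^sub>0 [x, n] = act x (\<tau> n) - \<tau> (bracketG x n)"
proof -
  have "act n (P x) = bracketN (\<tau> n) (P x)"
    using act_alpha[of "\<tau> n" "P x"] by (simp add: alpha_tau[OF assms])
  moreover have "bracketN (P x) (\<tau> n) = - bracketN (\<tau> n) (P x)" by (rule N.bracket_flip)
  moreover have "q n = q 0" using assms by (simp add: q_eq_iff)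
  ultimately show ?thesis
    by (simp add: f0_pair P_image assms ideal_left Omega_simps')
qed

section \<open>The covariant differential as the descended differential of
  \<open>f\<^sub>0\<close>\<close>

abbreviation "d\<omega> \<equiv> covariant_diff \<gg>quot (\<lambda>X. act (\<sigma> X)) \<omega>"

text \<open>A bracket with \<open>\<omega> [q y, q w]\<close> depends only on its image under
  \<alpha>, by \<open>act_alpha\<close>. So \<omega> may be traded there for the expression in
  \<open>P\<close> with the same image, although the two differ by a kernel element.\<close>

lemma bracket_P_omega:
  "bracketN (P x) (\<omega> [q y, q w]) =
    bracketN (P x) (act w (P y) - act y (P w) + bracketN (P y) (P w) + P (bracketG y w))"
  by (subst (1 2) N.bracket_flip) (simp only: alpha_omega flip: act_alpha)

text \<open>By \<open>section_act\<close>, the terms in \<omega> outside brackets form the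
  differential of the pulled-back \<omega>, and \<open>bracket_P_omega\<close> removes the others.
  With R = dP - [P,P]/2, the remaining identity is that dR is the cyclic sum of the brackets of P x
  with R(y, w).\<close>

lemma covariant_diff_pullback_3: "d\<omega> (map q [x, y, w]) = lie_diff \<gg>hat act f\<^sub>0 [x, y, w]"
proof -
  have flip: "bracketN (act a (P b)) (P c) = - bracketN (P c) (act a (P b))"
    "bracketN (P (bracketG a b)) (P c) = - bracketN (P c) (P (bracketG a b))" for a b c
    by (rule N.bracket_flip)+
  \<comment> \<open>Each Jacobi identity is fixed to this one triple and eliminates one of its three
    cyclic terms, so rewriting ends in a normal form.\<close>
  have jac: "bracketN (P x) (bracketN (P y) (P w)) =
      - (bracketN (P y) (bracketN (P w) (P x)) + bracketN (P w) (bracketN (P x) (P y)))"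
    unfolding eq_neg_iff_add_eq_0 using N.jacobi[of "P x" "P y" "P w"] by (simp add: add.assoc)
  have flipG: "P (bracketG (bracketG a b) c) = - P (bracketG c (bracketG a b))" for a b c
    by (subst L.bracket_flip) (rule P_uminus)
  have jacG: "P (bracketG x (bracketG y w)) =
      - (P (bracketG y (bracketG w x)) + P (bracketG w (bracketG x y)))"
    unfolding eq_neg_iff_add_eq_0 using L.jacobi[of x y w]
    by (simp only: P_simps(1)[symmetric] add.assoc P_0)
  show ?thesis
    unfolding lie_diff_hat_cyclic[OF f0_cochain]
    by (simp add: covariant_diff_def topspace_quot_topology q_bracket section_act f0_pair
        bracket_P_omega act_right act_bracket act_bracketN brN_right flip jac flipG jacG)
qed

lemma covariant_diff_pullback: "d\<omega> (map q xs) = lie_diff \<gg>hat act f\<^sub>0 xs"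
proof (cases "length xs = 3")
  case True
  then show ?thesis using covariant_diff_pullback_3 by (auto elim: length_3_cases)
next
  case False
  then have "d\<omega> (map q xs) = 0"
    by (auto simp: covariant_diff_def split: list.splits)
  with False show ?thesis by (simp add: lie_diff_hat_outside[OF f0_cochain])
qed

text \<open>The formula does not show that the values are central, since \<omega> takes values in
  the whole type; this is inherited from \<open>f\<^sub>0\<close> by descent.\<close>

lemma covariant_diff_cochain: "d\<omega> \<in> cochains 3 \<gg>quot scaleN \<ff>\<zz>"
proof (rule cochains_descend)
  show "d\<omega> Xs = 0" if "\<not> (length Xs = 3 \<and> set Xs \<subseteq> tvs_carrier \<gg>quot)" for Xs
    using that by (auto simp: covariant_diff_def split: list.splits)
  show "(\<lambda>xs. d\<omega> (map q xs)) \<in> cochains 3 \<gg>hat scaleN \<ff>\<zz>"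
    unfolding covariant_diff_pullback by (rule lie_diff_hat_cochains[OF f0_cochain])
qed

lemma covariant_diff_cocycle: "d\<omega> \<in> cocycles 3 \<gg>quot (quot_act act) scaleN \<ff>\<zz>"
proof -
  have Z: "d\<omega> Xs \<in> \<ff>\<zz>" for Xs
    by (rule cochains_value_subspace[OF covariant_diff_cochain])
  have "lie_diff \<gg>quot (quot_act act) d\<omega> Xs = 0" for Xs
  proof (cases "set Xs \<subseteq> range q")
    case True
    then obtain xs where "Xs = map q xs" by (rule lists_quot)
    then show ?thesis
      by (simp add: lie_diff_quot[OF Z] covariant_diff_pullback lie_diff_lie_diff_hat[OF f0_cochain])
  qed (simp add: lie_diff_def topspace_quot_topology)
  with covariant_diff_cochain show ?thesis by (auto simp: cocycles_def)
qed

section \<open>The central extension in the coordinates given by \<tau>; its cocycle measures how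
  far \<tau> is from preserving brackets\<close>

definition f\<^sub>\<tau> :: "'g list \<Rightarrow> 'n" where
  "f\<^sub>\<tau> ns = (if length ns = 2 \<and> set ns \<subseteq> range \<alpha>
     then bracketN (\<tau> (ns ! 0)) (\<tau> (ns ! 1)) - \<tau> (bracketG (ns ! 0) (ns ! 1)) else 0)"

abbreviation "\<nn>_lie \<equiv> sub_lie scaleG bracketG (range \<alpha>)"

lemma ftau_pair:
  "m \<in> range \<alpha> \<Longrightarrow> n \<in> range \<alpha> \<Longrightarrow> f\<^sub>\<tau> [m, n] = bracketN (\<tau> m) (\<tau> n) - \<tau> (bracketG m n)"
  by (simp add: f\<^sub>\<tau>_def)

lemma ftau_kernel: "m \<in> range \<alpha> \<Longrightarrow> n \<in> range \<alpha> \<Longrightarrow> f\<^sub>\<tau> [m, n] \<in> \<ff>\<zz>"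
  by (simp add: ftau_pair alpha_simps alpha_bracket alpha_tau ideal_left)

lemma cont_tau:
  "continuous_map T (top_of_set (range \<alpha>)) a \<Longrightarrow> continuous_map T euclidean (\<lambda>t. \<tau> (a t))"
  using continuous_map_compose[OF _ tau_continuous] by (fastforce simp: o_def)

lemma image_closed:
  "m \<in> range \<alpha> \<Longrightarrow> n \<in> range \<alpha> \<Longrightarrow> m + n \<in> range \<alpha>" "m \<in> range \<alpha> \<Longrightarrow> scaleG c m \<in> range \<alpha>"
  using L.subspace_add[OF subspace_image] L.subspace_scale[OF subspace_image] by blast+

lemma ftau_cocycle: "f\<^sub>\<tau> \<in> cocycles 2 \<nn>_lie (\<lambda>_ _. 0) scaleN \<ff>\<zz>"
proof -
  have "f\<^sub>\<tau> \<in> cochains 2 \<nn>_lie scaleN \<ff>\<zz>"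
  proof (rule cochains_2I)
    show "f\<^sub>\<tau> xs = 0" if "\<not> (length xs = 2 \<and> set xs \<subseteq> tvs_carrier \<nn>_lie)" for xs
      using that by (auto simp: f\<^sub>\<tau>_def)
    show "f\<^sub>\<tau> [x, y] \<in> \<ff>\<zz>" if "x \<in> tvs_carrier \<nn>_lie" "y \<in> tvs_carrier \<nn>_lie" for x y
      using that by (intro ftau_kernel) auto
    fix x assume "x \<in> tvs_carrier \<nn>_lie"
    then have x: "x \<in> range \<alpha>" by simp
    show "tvs_linear \<nn>_lie scaleN (\<lambda>y. f\<^sub>\<tau> [y, x])"
      using x unfolding tvs_linear_def
      by (simp del: ball_simps image_iff add: ftau_pair image_closed ideal_left brG_left brN_left
          tau_simps N.scale_right_diff_distrib)
    show "tvs_linear \<nn>_lie scaleN (\<lambda>y. f\<^sub>\<tau> [x, y])"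
      using x unfolding tvs_linear_def
      by (simp del: ball_simps image_iff add: ftau_pair image_closed ideal_left brG_right brN_right
          tau_simps N.scale_right_diff_distrib)
    show "f\<^sub>\<tau> [x, x] = 0"
      using x by (simp add: ftau_pair L.bracket_self N.bracket_self tau_0)
  next
    let ?T = "prod_topology (tvs_top \<nn>_lie) (tvs_top \<nn>_lie)"
    have f: "continuous_map ?T (top_of_set (range \<alpha>)) fst"
      and s: "continuous_map ?T (top_of_set (range \<alpha>)) snd"
      by (simp_all only: sub_lie_simps continuous_map_fst continuous_map_snd)
    note fs = f[THEN continuous_map_into_fulltopology] s[THEN continuous_map_into_fulltopology]
    have "continuous_map ?T (top_of_set (range \<alpha>)) (\<lambda>t. bracketG (fst t) (snd t))"
      using cont_brG[OF fs] by (auto simp: continuous_map_in_subtopology intro!: ideal_left)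
    then have "continuous_map ?T euclidean
        (\<lambda>t. bracketN (\<tau> (fst t)) (\<tau> (snd t)) - \<tau> (bracketG (fst t) (snd t)))"
      by (intro continuous_map_minus cont_brN cont_tau f s)
    then have "continuous_map ?T euclidean (\<lambda>t. f\<^sub>\<tau> [fst t, snd t])"
      by (rule continuous_map_eq) (auto simp: ftau_pair)
    then show "continuous_map ?T (top_of_set \<ff>\<zz>) (\<lambda>(x, y). f\<^sub>\<tau> [x, y])"
      using ftau_kernel by (auto simp: continuous_map_in_subtopology case_prod_beta')
  qed
  moreover have "lie_diff \<nn>_lie (\<lambda>_ _. 0) f\<^sub>\<tau> xs = 0" for xs
  proof (cases "length xs = 3 \<and> set xs \<subseteq> range \<alpha>")
    case True
    then obtain x y z where xs: "xs = [x, y, z]" and r: "x \<in> range \<alpha>" "y \<in> range \<alpha>" "z \<in> range \<alpha>"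
      by (auto elim!: length_3_cases)
    \<comment> \<open>The elements \<open>\<tau> (bracketG a b)\<close> and
      \<open>bracketN (\<tau> a) (\<tau> b)\<close> differ by a central one, so they are
      interchangeable inside a bracket. The cocycle identity then splits into Jacobi for the domain
      of \<alpha> and \<tau> of Jacobi for its image.\<close>
    have br: "bracketN (\<tau> (bracketG a b)) (\<tau> c) = bracketN (bracketN (\<tau> a) (\<tau> b)) (\<tau> c)"
      if "a \<in> range \<alpha>" "b \<in> range \<alpha>" for a b c
      using kernel_central(1)[OF ftau_kernel[OF that], of "\<tau> c"] by (simp add: ftau_pair that brN_left)
    have "\<tau> (bracketG (bracketG x z) y) =
        \<tau> (bracketG (bracketG x y) z) + \<tau> (bracketG (bracketG y z) x)"
      using r by (simp add: L.jacobi_left[of x z y] tau_simps ideal_left ideal_right)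
    moreover note N.jacobi_left[of "\<tau> x" "\<tau> z" "\<tau> y"]
    ultimately show ?thesis
      using r by (simp add: xs lie_diff_3 ftau_pair ideal_left ideal_right br)
  next
    case False
    then show ?thesis by (intro lie_diff_outside[of 2]) (auto simp: f\<^sub>\<tau>_def)
  qed
  ultimately show ?thesis by (auto simp: cocycles_def)
qed

abbreviation "\<phi>\<^sub>\<tau> \<equiv> \<lambda>(z, n). z + \<tau> n"

text \<open>Kernel components drop out of brackets by centrality, so the bracket of two elements is
  that of their \<tau>-parts, which is the cocycle plus \<tau> of the bracket.\<close>

lemma extension_iso_tau:
  "central_extension_iso scaleN bracketN scaleG bracketG \<alpha> f\<^sub>\<tau> \<phi>\<^sub>\<tau>"
proof -
  let ?T = "prod_topology (top_of_set \<ff>\<zz>) (top_of_set (range \<alpha>))"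
  have "homeomorphic_maps ?T euclidean \<phi>\<^sub>\<tau> (\<lambda>h. (h - \<tau> (\<alpha> h), \<alpha> h))"
    unfolding homeomorphic_maps_def
  proof (intro conjI)
    have "continuous_map ?T euclidean fst"
      by (rule continuous_map_into_fulltopology[OF continuous_map_fst])
    then have "continuous_map ?T euclidean (\<lambda>t. fst t + \<tau> (snd t))"
      by (intro continuous_map_plus cont_tau continuous_map_snd)
    then show "continuous_map ?T euclidean \<phi>\<^sub>\<tau>" by (simp add: case_prod_beta')
    have a: "continuous_map euclidean (top_of_set (range \<alpha>)) \<alpha>"
      using alpha_continuous by (simp add: continuous_map_in_subtopology)
    have i: "continuous_map euclidean euclidean (\<lambda>h :: 'n. h)" by simp
    have "continuous_map euclidean euclidean (\<lambda>h. h - \<tau> (\<alpha> h))"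
      by (rule continuous_map_minus[OF i cont_tau[OF a]])
    with a show "continuous_map euclidean ?T (\<lambda>h. (h - \<tau> (\<alpha> h), \<alpha> h))"
      by (intro continuous_map_pairedI) (auto simp: continuous_map_in_subtopology alpha_simps alpha_tau)
  qed (auto simp: alpha_simps alpha_tau)
  then have "homeomorphic_map ?T euclidean \<phi>\<^sub>\<tau>" unfolding homeomorphic_map_maps by blast
  then show ?thesis
    unfolding central_extension_iso_def
    using ftau_kernel
    by (simp del: ball_simps image_iff mem_Collect_eq add: tau_simps tau_0 ftau_pair brN_left brN_right
        kernel_central N.scale_right_distrib add_ac)
      (simp add: alpha_simps alpha_tau)
qed

section \<open>Representatives of the characteristic class for a given \<tau>\<close>

lemma theta_kernel: "n \<in> range \<alpha> \<Longrightarrow> act x (\<tau> n) - \<tau> (bracketG x n) \<in> \<ff>\<zz>"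
  by (simp add: alpha_simps alpha_act alpha_tau ideal_left)

lemma characteristic_cocycle_covariant_diff:
  "characteristic_cocycle scaleN bracketN scaleG bracketG act \<alpha> d\<omega>"
proof -
  \<comment> \<open>Forced by the coordinates: it is the kernel component of
    \<open>act x (\<tau> n)\<close>, whose image under \<alpha> is
    \<open>bracketG x n\<close>.\<close>
  let ?\<theta> = "\<lambda>x n. act x (\<tau> n) - \<tau> (bracketG x n)"
  let ?T = "prod_topology euclidean (top_of_set (range \<alpha>)) :: ('g \<times> 'g) topology"
  have 1: "tvs_linear \<nn>_lie scaleN (?\<theta> x)" for x
    unfolding tvs_linear_def
    by (simp del: ball_simps image_iff add: tau_simps act_right brG_right ideal_left
        N.scale_right_diff_distrib)
  have 2: "tvs_linear \<gg>hat scaleN (\<lambda>x. ?\<theta> x n)" if "n \<in> range \<alpha>" for n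
    using that by (simp add: tvs_linear_def tau_simps act_left brG_left ideal_left
        N.scale_right_diff_distrib)
  have 3: "continuous_map ?T (top_of_set \<ff>\<zz>) (\<lambda>(x, n). ?\<theta> x n)"
  proof -
    have f: "continuous_map ?T euclidean fst" by (rule continuous_map_fst)
    have s: "continuous_map ?T (top_of_set (range \<alpha>)) snd" by (rule continuous_map_snd)
    then have s': "continuous_map ?T euclidean snd" by (rule continuous_map_into_fulltopology)
    have "continuous_map ?T (top_of_set (range \<alpha>)) (\<lambda>t. bracketG (fst t) (snd t))"
      using cont_brG[OF f s'] by (auto simp: continuous_map_in_subtopology intro!: ideal_left)
    then have "continuous_map ?T euclidean (\<lambda>t. ?\<theta> (fst t) (snd t))"
      by (intro continuous_map_minus cont_act cont_tau f s)
    then show ?thesis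
      using theta_kernel by (auto simp: continuous_map_in_subtopology case_prod_beta')
  qed
  show ?thesis
    unfolding characteristic_cocycle_def Let_def
  proof (intro conjI exI)
    show "d\<omega> \<in> cocycles 3 \<gg>quot (quot_act act) scaleN \<ff>\<zz>" by (rule covariant_diff_cocycle)
    show "f\<^sub>\<tau> \<in> cocycles 2 \<nn>_lie (\<lambda>_ _. 0) scaleN \<ff>\<zz>" by (rule ftau_cocycle)
    show "central_extension_iso scaleN bracketN scaleG bracketG \<alpha> f\<^sub>\<tau> \<phi>\<^sub>\<tau>"
      by (rule extension_iso_tau)
    show "\<forall>x. tvs_linear \<nn>_lie scaleN (?\<theta> x)" "\<forall>n\<in>range \<alpha>. tvs_linear \<gg>hat scaleN (\<lambda>x. ?\<theta> x n)"
      using 1 2 by blast+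
    show "continuous_map ?T (top_of_set \<ff>\<zz>) (\<lambda>(x, n). ?\<theta> x n)" by (rule 3)
    show "\<forall>x. \<forall>z\<in>\<ff>\<zz>. \<forall>n\<in>range \<alpha>. act x (\<phi>\<^sub>\<tau> (z, n)) = \<phi>\<^sub>\<tau> (act x z + ?\<theta> x n, bracketG x n)"
      by (simp add: act_right)
    show "f\<^sub>0 \<in> cochains 2 \<gg>hat scaleN \<ff>\<zz>" by (rule f0_cochain)
    show "\<forall>x. \<forall>n\<in>range \<alpha>. f\<^sub>0 [x, n] = ?\<theta> x n"
      using f0_image by blast
    show "lie_diff \<gg>hat act f\<^sub>0 = (\<lambda>xs. d\<omega> (map q xs))"
      by (simp add: covariant_diff_pullback)
  qed
qed

lemma cohomologous_covariant_diff:
  assumes f': "f' \<in> cochains 2 \<gg>hat scaleN \<ff>\<zz>"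
    and theta: "\<And>x n. n \<in> range \<alpha> \<Longrightarrow> f' [x, n] = act x (\<tau> n) - \<tau> (bracketG x n)"
    and beta: "\<beta> \<in> cochains 3 \<gg>quot scaleN \<ff>\<zz>" "lie_diff \<gg>hat act f' = (\<lambda>xs. \<beta> (map q xs))"
  shows "(\<lambda>Xs. \<beta> Xs - d\<omega> Xs) \<in> coboundaries 3 \<gg>quot (quot_act act) scaleN \<ff>\<zz>"
proof -
  define g where "g = (\<lambda>xs. f' xs - f\<^sub>0 xs)"
  define \<gamma> where "\<gamma> Xs = (if length Xs = 2 \<and> set Xs \<subseteq> range q then g (map \<sigma> Xs) else 0)" for Xs
  have g: "g \<in> cochains 2 \<gg>hat scaleN \<ff>\<zz>"
    unfolding g_def by (rule N.cochains_minus[OF subspace_kernel f' f0_cochain])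
  have g0: "g [x, n] = 0" "g [n, x] = 0" if "n \<in> range \<alpha>" for x n
    using cochain_hat_flip[OF g, of n x] by (simp_all add: g_def theta f0_image that)
  \<comment> \<open>Replacing \<open>x\<close> by \<open>\<sigma> (q x)\<close> subtracts an element
    of the image of \<alpha>, on which \<open>g\<close> vanishes in either slot. Hence \<gamma>,
    defined by lifts, pulls back to \<open>g\<close>.\<close>
  have gs: "g [\<sigma> (q x), \<sigma> (q y)] = g [x, y]" for x y
  proof -
    have "g [x - m, y - n] = g [x, y]" if "m \<in> range \<alpha>" "n \<in> range \<alpha>" for m n
      using that by (simp add: cochain_hat_simps'(5,6)[OF g] g0)
    from this[OF minus_section[of x] minus_section[of y]] show ?thesis by simp
  qed
  have pull: "\<gamma> (map q xs) = g xs" for xs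
  proof (cases "length xs = 2")
    case True
    then show ?thesis by (auto simp: \<gamma>_def gs elim!: length_2_cases)
  next
    case False
    then show ?thesis using cochains_outside[OF g] by (simp add: \<gamma>_def)
  qed
  have gam: "\<gamma> \<in> cochains 2 \<gg>quot scaleN \<ff>\<zz>"
  proof (rule cochains_descend)
    show "\<gamma> Xs = 0" if "\<not> (length Xs = 2 \<and> set Xs \<subseteq> tvs_carrier \<gg>quot)" for Xs
      using that by (auto simp: \<gamma>_def topspace_quot_topology)
    show "(\<lambda>xs. \<gamma> (map q xs)) \<in> cochains 2 \<gg>hat scaleN \<ff>\<zz>"
      unfolding pull by (rule g)
  qed
  have "\<beta> Xs - d\<omega> Xs = lie_diff \<gg>quot (quot_act act) \<gamma> Xs" for Xs
  proof (cases "set Xs \<subseteq> range q")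
    case True
    then obtain xs where Xs: "Xs = map q xs" by (rule lists_quot)
    have Z: "\<gamma> Ys \<in> \<ff>\<zz>" for Ys
      by (rule cochains_value_subspace[OF gam])
    \<comment> \<open>Every list of cosets is a pullback point, so the equation can be read off from
      the differentials of \<open>f'\<close> and \<open>f\<^sub>0\<close> on the extended
      algebra.\<close>
    have "lie_diff \<gg>quot (quot_act act) \<gamma> Xs = lie_diff \<gg>hat act g xs"
      by (simp add: Xs lie_diff_quot[OF Z] pull)
    also have "\<dots> = lie_diff \<gg>hat act f' xs - lie_diff \<gg>hat act f\<^sub>0 xs"
      unfolding g_def by (rule lie_diff_minus[OF act_right(2)])
    also have "\<dots> = \<beta> Xs - d\<omega> Xs"
      by (simp add: beta(2) covariant_diff_pullback Xs)
    finally show ?thesis by simp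
  next
    case False
    then show ?thesis
      using cochains_outside[OF beta(1), of Xs] cochains_outside[OF covariant_diff_cochain, of Xs]
      by (simp add: lie_diff_def topspace_quot_topology)
  qed
  with gam show ?thesis by (auto simp: coboundaries_def numeral_3_eq_3 numeral_2_eq_2)
qed

end

subsection \<open>The characteristic class\<close>

text \<open>The splitting gives a section over the quotient by the kernel. Its cosets are the fibres
  of \<alpha>, so the section transfers to the image. Continuity there for the subspace topology
  comes from \<open>extension\<close>: it suffices that the composite with \<alpha> is
  continuous.\<close>

lemma (in topologically_split_crossed_module) continuous_section_exists:
  obtains \<tau> where "tvs_linear (sub_lie scaleG bracketG (range \<alpha>)) scaleN \<tau>"
    "continuous_map (top_of_set (range \<alpha>)) euclidean \<tau>"
    "\<And>n. n \<in> range \<alpha> \<Longrightarrow> \<alpha> (\<tau> n) = n"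
proof -
  obtain s where s: "continuous_linear_section scaleN \<ff>\<zz> s"
    using split_kernel by (auto simp: topologically_split_def)
  let ?c = "coset \<ff>\<zz>"
  define \<tau> where "\<tau> n = s (?c (SOME h. \<alpha> h = n))" for n
  have ceq: "?c x = ?c y \<longleftrightarrow> \<alpha> x = \<alpha> y" for x y
    using coset_eq_iff[OF subspace_kernel N.vector_space_axioms] by (simp add: alpha_simps)
  have tau: "\<tau> (\<alpha> h) = s (?c h)" for h
  proof -
    have "\<alpha> (SOME k. \<alpha> k = \<alpha> h) = \<alpha> h" by (rule someI) simp
    then show ?thesis unfolding \<tau>_def using ceq by metis
  qed
  have lin: "s (?c (x + y)) = s (?c x) + s (?c y)" "s (?c (scaleN c x)) = scaleN c (s (?c x))" for x y c
  proof -
    have l: "tvs_linear (quot_tvs scaleN \<ff>\<zz>) scaleN s"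
      using s by (simp add: continuous_linear_section_def)
    have c: "?c x \<in> tvs_carrier (quot_tvs scaleN \<ff>\<zz>)" for x
      by (simp add: quot_tvs_simps topspace_quot_topology)
    note p = N.quot_plus_coset[OF subspace_kernel, of bracketN]
      N.quot_scale_coset[OF subspace_kernel, of bracketN]
    show "s (?c (x + y)) = s (?c x) + s (?c y)" "s (?c (scaleN c x)) = scaleN c (s (?c x))"
      using l c unfolding tvs_linear_def quot_tvs_simps(1) quot_tvs_simps(2,3)[where b = bracketN]
        p[symmetric] by blast+
  qed
  have "tvs_linear (sub_lie scaleG bracketG (range \<alpha>)) scaleN \<tau>"
  proof -
    have "\<tau> (\<alpha> x + \<alpha> y) = \<tau> (\<alpha> x) + \<tau> (\<alpha> y)" "\<tau> (scaleG c (\<alpha> x)) = scaleN c (\<tau> (\<alpha> x))" for x y c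
      using tau[of "x + y"] tau[of "scaleN c x"] by (simp_all add: alpha_simps tau lin)
    then show ?thesis by (auto simp: tvs_linear_def)
  qed
  moreover have "continuous_map (top_of_set (range \<alpha>)) euclidean \<tau>"
  proof (rule continuous_compose_quotient_map[OF extension])
    have "continuous_map euclidean euclidean (s \<circ> ?c)"
      using s quotient_imp_continuous_map[OF quotient_map_coset]
      by (intro continuous_map_compose[of _ "quot_topology \<ff>\<zz>"])
        (simp_all add: continuous_linear_section_def)
    then show "continuous_map euclidean euclidean (\<tau> \<circ> \<alpha>)" by (simp add: o_def tau)
  qed
  moreover have "\<alpha> (\<tau> n) = n" if "n \<in> range \<alpha>" for n
  proof -
    obtain h where h: "n = \<alpha> h" using \<open>n \<in> range \<alpha>\<close> by blast
    have "?c (s (?c h)) = ?c h" using s by (auto simp: continuous_linear_section_def)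
    then show ?thesis by (simp add: h tau ceq)
  qed
  ultimately show ?thesis using that by blast
qed

text \<open>Independence of all choices at once: whatever presentation produced \<beta>, it is
  compared with the one cocycle d_S \<omega>, which depends on \<sigma> and \<omega> only.\<close>

lemma (in crossed_module_section) characteristic_cocycle_cohomologous:
  assumes omega: "\<omega> \<in> cochains 2 \<gg>quot scaleN UNIV"
    and curvature: "\<And>x y. bracketG (\<sigma> (q x)) (\<sigma> (q y)) - \<sigma> (q (bracketG x y)) = \<alpha> (\<omega> [q x, q y])"
    and beta: "characteristic_cocycle scaleN bracketN scaleG bracketG act \<alpha> \<beta>"
  shows "(\<lambda>Xs. \<beta> Xs - covariant_diff \<gg>quot (\<lambda>X. act (\<sigma> X)) \<omega> Xs)
    \<in> coboundaries 3 \<gg>quot (quot_act act) scaleN \<ff>\<zz>"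
proof -
  obtain f \<phi> \<theta> f' where
    b: "\<beta> \<in> cochains 3 \<gg>quot scaleN \<ff>\<zz>" and
    iso: "central_extension_iso scaleN bracketN scaleG bracketG \<alpha> f \<phi>" and
    theta: "continuous_map (prod_topology euclidean (top_of_set (range \<alpha>))) (top_of_set \<ff>\<zz>)
              (\<lambda>(x, n). \<theta> x n)" and
    a: "\<And>x z n. z \<in> \<ff>\<zz> \<Longrightarrow> n \<in> range \<alpha> \<Longrightarrow> act x (\<phi> (z, n)) = \<phi> (act x z + \<theta> x n, bracketG x n)" and
    f': "f' \<in> cochains 2 \<gg>hat scaleN \<ff>\<zz>" "\<And>x n. n \<in> range \<alpha> \<Longrightarrow> f' [x, n] = \<theta> x n"
      "lie_diff \<gg>hat act f' = (\<lambda>xs. \<beta> (map q xs))"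
    using beta unfolding characteristic_cocycle_def Let_def cocycles_def by blast
  have z0: "0 \<in> \<ff>\<zz>" by (simp add: alpha_simps)
  have n0: "0 \<in> range \<alpha>" by (rule L.subspace_0[OF subspace_image])
  have add: "\<phi> (z + z', n + n') = \<phi> (z, n) + \<phi> (z', n')"
    if "z \<in> \<ff>\<zz>" "z' \<in> \<ff>\<zz>" "n \<in> range \<alpha>" "n' \<in> range \<alpha>" for z z' n n'
    using iso that unfolding central_extension_iso_def by blast
  have scale: "\<phi> (scaleN c z, scaleG c n) = scaleN c (\<phi> (z, n))"
    if "z \<in> \<ff>\<zz>" "n \<in> range \<alpha>" for c z n
    using iso that unfolding central_extension_iso_def by blast
  have ker: "\<phi> (z, 0) = z" if "z \<in> \<ff>\<zz>" for z
    using iso that unfolding central_extension_iso_def by blast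
  have over: "\<alpha> (\<phi> (z, n)) = n" if "z \<in> \<ff>\<zz>" "n \<in> range \<alpha>" for z n
    using iso that unfolding central_extension_iso_def by blast
  have cont: "continuous_map (prod_topology (top_of_set \<ff>\<zz>) (top_of_set (range \<alpha>))) euclidean \<phi>"
    using iso unfolding central_extension_iso_def by (blast dest: homeomorphic_imp_continuous_map)
  define \<tau> where "\<tau> n = \<phi> (0, n)" for n
  \<comment> \<open>Since \<phi> is additive and the identity on the kernel,
    \<open>\<phi> (z, n) = z + \<tau> n\<close>. So the given \<theta> is the one belonging to this
    \<tau>.\<close>
  have theta_val: "\<theta> x n = act x (\<tau> n) - \<tau> (bracketG x n)" if n: "n \<in> range \<alpha>" for x n
  proof -
    have "\<theta> x n \<in> \<ff>\<zz>"
      using theta n by (auto simp: continuous_map_in_subtopology Pi_iff)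
    then have "\<phi> (\<theta> x n, bracketG x n) = \<theta> x n + \<tau> (bracketG x n)"
      using add[OF _ z0 n0 ideal_left[OF n]] by (simp add: \<tau>_def ker)
    then show ?thesis using a[OF z0 n, of x] by (simp add: \<tau>_def act_right)
  qed
  have "crossed_module_lift scaleN bracketN scaleG bracketG act \<alpha> \<sigma> \<omega> \<tau>"
  proof (intro crossed_module_lift.intro crossed_module_lift_axioms.intro)
    show "crossed_module_section scaleN bracketN scaleG bracketG act \<alpha> \<sigma>" ..
    show "tvs_linear (sub_lie scaleG bracketG (range \<alpha>)) scaleN \<tau>"
      unfolding tvs_linear_def \<tau>_def
      using add[OF z0 z0] scale[OF z0] by (simp del: ball_simps image_iff)
    have "continuous_map (top_of_set (range \<alpha>))
        (prod_topology (top_of_set \<ff>\<zz>) (top_of_set (range \<alpha>))) (\<lambda>n. (0, n))"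
      using z0 by (intro continuous_map_pairedI) auto
    from continuous_map_compose[OF this cont]
    show "continuous_map (top_of_set (range \<alpha>)) euclidean \<tau>" by (simp add: o_def \<tau>_def)
    show "\<alpha> (\<tau> n) = n" if "n \<in> range \<alpha>" for n
      unfolding \<tau>_def by (rule over[OF z0 that])
  qed (fact omega curvature)+
  then interpret crossed_module_lift scaleN bracketN scaleG bracketG act \<alpha> \<sigma> \<omega> \<tau> .
  show ?thesis
    by (rule cohomologous_covariant_diff[OF f'(1) _ b f'(3)]) (simp add: f'(2) theta_val)
qed

theorem mainTheorem7:
  fixes scaleN :: "'k::topological_field_char_0 \<Rightarrow> 'n::{topological_ab_group_add, t2_space} \<Rightarrow> 'n"
    and bracketN :: "'n \<Rightarrow> 'n \<Rightarrow> 'n"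
    and scaleG :: "'k \<Rightarrow> 'g::{topological_ab_group_add, t2_space} \<Rightarrow> 'g"
    and bracketG :: "'g \<Rightarrow> 'g \<Rightarrow> 'g"
    and act :: "'g \<Rightarrow> 'n \<Rightarrow> 'n"
    and \<alpha> :: "'n \<Rightarrow> 'g"
    and \<gg> :: "('k, 'g set) tlie"
    and \<zz> :: "'n set"
    and \<sigma> :: "'g set \<Rightarrow> 'g"
    and S :: "'g set \<Rightarrow> 'n \<Rightarrow> 'n"
    and \<omega> :: "'g set list \<Rightarrow> 'n"
  assumes "topologically_split_crossed_module scaleN bracketN scaleG bracketG act \<alpha>"
    and "\<gg> = quot_lie scaleG bracketG (range \<alpha>)"
    and "\<zz> = {h. \<alpha> h = 0}"
    and "continuous_linear_section scaleG (range \<alpha>) \<sigma>"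
    and "\<And>X h. S X h = act (\<sigma> X) h"
    and "\<omega> \<in> cochains 2 \<gg> scaleN UNIV"
    and "\<And>X Y. X \<in> tvs_carrier \<gg> \<Longrightarrow> Y \<in> tvs_carrier \<gg> \<Longrightarrow>
           bracketG (\<sigma> X) (\<sigma> Y) - \<sigma> (tlie_bracket \<gg> X Y) = \<alpha> (\<omega> [X, Y])"
  shows "covariant_diff \<gg> S \<omega> \<in> cocycles 3 \<gg> (quot_act act) scaleN \<zz> \<and>
    characteristic_class scaleN bracketN scaleG bracketG act \<alpha> =
      cohomology_class 3 \<gg> (quot_act act) scaleN \<zz> (covariant_diff \<gg> S \<omega>)"
proof -
  interpret topologically_split_crossed_module scaleN bracketN scaleG bracketG act \<alpha> by fact
  interpret crossed_module_section scaleN bracketN scaleG bracketG act \<alpha> \<sigma>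
    by unfold_locales fact
  have g: "\<gg> = \<gg>quot" and z: "\<zz> = \<ff>\<zz>" and S: "S = (\<lambda>X. act (\<sigma> X))"
    using assms(2,3,5) by auto
  have omega: "\<omega> \<in> cochains 2 \<gg>quot scaleN UNIV" using assms(6) g by simp
  have curvature: "bracketG (\<sigma> (q x)) (\<sigma> (q y)) - \<sigma> (q (bracketG x y)) = \<alpha> (\<omega> [q x, q y])" for x y
    using assms(7)[of "q x" "q y"] by (simp add: g topspace_quot_topology q_bracket)
  \<comment> \<open>This section shows that some characteristic cocycle exists, namely d_S
    \<omega>.\<close>
  obtain \<tau> where tau: "tvs_linear (sub_lie scaleG bracketG (range \<alpha>)) scaleN \<tau>"
    "continuous_map (top_of_set (range \<alpha>)) euclidean \<tau>"
    "\<And>n. n \<in> range \<alpha> \<Longrightarrow> \<alpha> (\<tau> n) = n"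
    using continuous_section_exists by blast
  interpret crossed_module_lift scaleN bracketN scaleG bracketG act \<alpha> \<sigma> \<omega> \<tau>
    by unfold_locales (fact omega curvature tau)+
  let ?class = "cohomology_class 3 \<gg>quot (quot_act act) scaleN \<ff>\<zz>"
  \<comment> \<open>The uniqueness half of the definite description; here \<beta> may come from a
    presentation unrelated to the \<tau> just fixed.\<close>
  have "?class \<beta> = ?class d\<omega>"
    if "characteristic_cocycle scaleN bracketN scaleG bracketG act \<alpha> \<beta>" for \<beta>
    using N.cohomology_class_eqI[where p = 2 and a = "quot_act act", OF subspace_kernel quot_act_minus]
      characteristic_cocycle_cohomologous[OF omega curvature that]
    by (simp add: numeral_3_eq_3 numeral_2_eq_2)
  with characteristic_cocycle_covariant_diff
  have "characteristic_class scaleN bracketN scaleG bracketG act \<alpha> = ?class d\<omega>"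
    unfolding characteristic_class_def by (intro the_equality) metis+
  with covariant_diff_cocycle show ?thesis unfolding g z S by (rule conjI)
qed

end
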